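(* Let $A \subset \mathbb{R}^n$ be a Lebesgue measurable set and let $\varphi : A \to \mathbb{R}^n$ be a Lebesgue measurable mapping. Suppose there exists a sequence of Lebesgue measurable sets $\{A_m\}_{m=1}^\infty$, $A_m\subset A$, with $A_m \subset A_{m+1}$ and $\varphi|_{A_m}$ Lipschitz continuous for every $m \in \mathbb{N}$. Denote $S := A \setminus \bigcup_{m=1}^\infty A_m$. Then, for any non-negative Lebesgue measurable function $f : A \to \mathbb{R}$, $$\int_{A\setminus S} f(x)\, |J(x, \varphi)| \, dx = \int_{\mathbb{R}^n} \left( \sum_{x \in \varphi^{-1}\{y\} \cap (A \setminus S)} f(x) \right) dy .$$
   Context: $J(x,\varphi) = \det(D\varphi(x))$ is the Jacobian of $\varphi$ at $x$, where $D\varphi(x)$ is the approximate differential of $\varphi$ at $x$: for a point $x\in A$ of Lebesgue density $1$ of $A$, it is the linear map $L:\mathbb{R}^n\to\mathbb{R}^n$ (if it exists) such that for every $\varepsilon>0$ the set $\{z\in A : |\varphi(z)-\varphi(x)-L(z-x)|>\varepsilon|z-x|\}$ has Lebesgue density $0$ at $x$. The function $x\mapsto J(x,\varphi)$ is understood as defined Lebesgue-almost everywhere on $A\setminus S$. Here $\varphi^{-1}\{y\}=\{x\in A:\varphi(x)=y\}$. Sums of non-negative terms over arbitrary index sets and integrals of non-negative functions take values in $[0,\infty]$; integration is with respect to $n$-dimensional Lebesgue measure. *)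

theory Defs
  imports "HOL-Analysis.Analysis"
begin

definition has_lebesgue_density :: "'a::euclidean_space set \<Rightarrow> 'a \<Rightarrow> real \<Rightarrow> bool" where
  "has_lebesgue_density E x d \<longleftrightarrow>
     E \<in> sets lebesgue \<and>
     ((\<lambda>r. measure lebesgue (E \<inter> ball x r) / measure lebesgue (ball x r)) \<longlongrightarrow> d) (at_right 0)"

definition has_approx_derivative ::
  "'a::euclidean_space set \<Rightarrow> ('a \<Rightarrow> 'b::real_normed_vector) \<Rightarrow> 'a \<Rightarrow> ('a \<Rightarrow> 'b) \<Rightarrow> bool" where
  "has_approx_derivative A \<phi> x L \<longleftrightarrow>
     x \<in> A \<and> has_lebesgue_density A x 1 \<and> linear L \<and>
     (\<forall>\<epsilon>>0. has_lebesgue_density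
               {z \<in> A. norm (\<phi> z - \<phi> x - L (z - x)) > \<epsilon> * norm (z - x)} x 0)"

(* Such an L is unique when it exists, because x is a density point of A; where none
   exists, the value of approx_derivative (and of approx_jacobian) is unspecified. *)
definition approx_derivative ::
  "'a::euclidean_space set \<Rightarrow> ('a \<Rightarrow> 'b::real_normed_vector) \<Rightarrow> 'a \<Rightarrow> ('a \<Rightarrow> 'b)" where
  "approx_derivative A \<phi> x = (THE L. has_approx_derivative A \<phi> x L)"

definition approx_jacobian :: "(real^'n) set \<Rightarrow> (real^'n \<Rightarrow> real^'n) \<Rightarrow> real^'n \<Rightarrow> real" where
  "approx_jacobian A \<phi> x = det (matrix (approx_derivative A \<phi> x))"

end

(*
McShane extension and Rademacher's theorem make phi differentiable within A_m at almost
every point of A_m, and at density points of A_m that derivative is the approximate derivative of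
phi with respect to A. Up to a null set, which phi maps to a null set, A - S is thus a countable
union of measurable pieces on which the Jacobian vanishes (their images are null by Sard's theorem)
or phi is injective (the classical change of variables applies). Both sides of the formula are
countably additive in f, so it suffices to verify it for indicators of subsets of the pieces.

Rademacher's theorem is obtained without integration by parts. For fixed e the points where all
difference quotients of f in direction v and step below 1/N are e-close to a form a closed set
P(v,a,N). Since Lipschitz functions of one real variable are differentiable almost everywhere, for
each v almost every point lies in such a set with a rational, and almost every point is a density
point of the P(v,a,N) containing it. At such a point f is affine up to an error O(e |h|): walk
along the coordinate directions and replace each intermediate point by a nearby point of P(v,a,N).
*)
theory Submission
  imports Defs
begin

subsection \<open>Change of variables over arbitrary finite index types\<close>

text \<open>In one variable the argument compares slopes. Adding \<open>(L + 1) * x\<close> to an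
  \<open>L\<close>-Lipschitz function puts all slopes between 1 and \<open>2 * L + 1\<close>, so it
  becomes a bi-Lipschitz bijection g of the line. If every point of E lies in arbitrarily short
  intervals of slope at most p and in others of slope at least q > p, Vitali's theorem gives |g(E)|
  \<le> p |E|, and for the inverse |E| \<le> |g(E)| / q. For E of finite measure this forces |E| =
  0. A point may lie in many A_m, and its derivative within A_m might depend on m. Uniqueness of the
  approximate derivative, taken with respect to A, excludes this, so one function serves all pieces.
  A nonzero Jacobian yields no neighbourhood on which phi is injective, since phi is controlled only
  within A_m. The injective pieces come from lower bounds |phi(z) - phi(x)| \<ge> |z - x| / k for z
  in A_m near x, cut down to small balls. The sum over a fibre is treated as an integral against
  counting measure; its measurability in y is part of the claim and is carried through every step
  together with the identity.\<close>

text \<open>The library proves change of variables and Sard's theorem for well-ordered index types only; the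
  isometry \<open>wo_vec\<close> onto vectors indexed by a well-ordered copy of the index type removes this restriction.\<close>

typedef 'a wo = "UNIV :: 'a set" by auto

instance wo :: (finite) finite
proof
  have "(UNIV :: 'a wo set) = Abs_wo ` UNIV"
    by (metis Abs_wo_cases rangeI UNIV_eq_I)
  then show "finite (UNIV :: 'a wo set)"
    by (metis finite finite_imageI)
qed

text \<open>A finite type embeds into the natural numbers by \<open>to_nat\<close>; the order is
  pulled back along this injection, and its induction rule is induction on the natural number
  attached to an element.\<close>

instantiation wo :: (finite) wellorder
begin

definition less_eq_wo :: "'a wo \<Rightarrow> 'a wo \<Rightarrow> bool" where
  "x \<le> y \<longleftrightarrow> to_nat (Rep_wo x) \<le> to_nat (Rep_wo y)"

definition less_wo :: "'a wo \<Rightarrow> 'a wo \<Rightarrow> bool" where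
  "x < y \<longleftrightarrow> to_nat (Rep_wo x) < to_nat (Rep_wo y)"

instance
proof (intro_classes, goal_cases)
  case (1 x y)
  show ?case unfolding less_eq_wo_def less_wo_def by linarith
next
  case (2 x)
  show ?case unfolding less_eq_wo_def by simp
next
  case (3 x y z)
  then show ?case unfolding less_eq_wo_def by linarith
next
  case (4 x y)
  then have "to_nat (Rep_wo x) = to_nat (Rep_wo y)" unfolding less_eq_wo_def by linarith
  then show ?case by (simp add: Rep_wo_inject)
next
  case (5 x y)
  show ?case unfolding less_eq_wo_def by linarith
next
  case (6 P a)
  show ?case
  proof (induction a rule: measure_induct_rule[where f = "\<lambda>x. to_nat (Rep_wo x)"])
    case (less x)
    then show ?case
      by (rule 6) (simp add: less_wo_def)
  qed
qed

end

definition wo_vec :: "'b^'n \<Rightarrow> 'b^('n::finite wo)" where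
  "wo_vec x = (\<chi> i. x $ Rep_wo i)"

definition unwo_vec :: "'b^('n::finite wo) \<Rightarrow> 'b^'n" where
  "unwo_vec x = (\<chi> i. x $ Abs_wo i)"

lemma unwo_vec_wo_vec [simp]: "unwo_vec (wo_vec x) = x" "wo_vec (unwo_vec y) = y"
  by (simp_all add: wo_vec_def unwo_vec_def Abs_wo_inverse Rep_wo_inverse)

lemma bij_Rep_wo: "bij Rep_wo"
  by (metis Abs_wo_inverse Rep_wo_inverse UNIV_I bijI')

lemma card_wo [simp]: "CARD('a wo) = CARD('a)"
  using bij_Rep_wo by (rule bij_betw_same_card)

lemma linear_wo_vec: "linear (wo_vec :: real^'n \<Rightarrow> _)" "linear (unwo_vec :: _ \<Rightarrow> real^'n)"
  by (auto intro!: linearI simp: wo_vec_def unwo_vec_def vec_eq_iff)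

lemma bij_wo_vec: "bij (wo_vec :: 'b^'n \<Rightarrow> _)"
  by (metis bijI' unwo_vec_wo_vec)

lemma continuous_on_wo_vec [continuous_intros]:
  "continuous_on S (wo_vec :: real^'n \<Rightarrow> _)" "continuous_on S' (unwo_vec :: _ \<Rightarrow> real^'n)"
  by (simp_all add: linear_continuous_on linear_conv_bounded_linear[symmetric] linear_wo_vec)

section \<open>Invariance of Lebesgue measure under renaming of coordinates\<close>

lemma prod_Basis_cart:
  fixes x :: "real^'n"
  shows "(\<Prod>b\<in>Basis. x \<bullet> b) = (\<Prod>i\<in>UNIV. x $ i)"
proof -
  have B: "(Basis :: (real^'n) set) = (\<lambda>i. axis i 1) ` UNIV"
    by (auto simp: Basis_vec_def)
  have inj: "inj (\<lambda>i. axis i 1 :: real^'n)"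
    by (auto simp: inj_on_def axis_eq_axis)
  show ?thesis
    unfolding B prod.reindex[OF inj] by (simp add: inner_axis)
qed

text \<open>A Borel measure that gives every box the product of its side lengths is Lebesgue
  measure, and renaming coordinates only permutes the factors of that product.\<close>

lemma distr_wo_vec_lborel: "distr lborel borel (wo_vec :: real^'n \<Rightarrow> _) = lborel"
proof (rule lborel_eqI[symmetric])
  fix l u :: "real^('n wo)"
  assume le: "\<And>b. b \<in> Basis \<Longrightarrow> l \<bullet> b \<le> u \<bullet> b"
  then have le': "l $ i \<le> u $ i" for i
    using le[of "axis i 1"] by (auto simp: inner_axis Basis_vec_def)
  have all: "(\<forall>i. P i) \<longleftrightarrow> (\<forall>j. P (Abs_wo j))" for P :: "'n wo \<Rightarrow> bool"
    by (metis Rep_wo_inverse)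
  have vim: "wo_vec -` box l u = box (unwo_vec l) (unwo_vec u)"
    by (auto simp: mem_box_cart all wo_vec_def unwo_vec_def Abs_wo_inverse)
  have meas: "(wo_vec :: real^'n \<Rightarrow> _) \<in> borel_measurable borel"
    by (intro borel_measurable_continuous_onI continuous_intros)
  have "emeasure (distr lborel borel wo_vec) (box l u) = emeasure lborel (box (unwo_vec l) (unwo_vec u))"
    using meas by (simp add: emeasure_distr vim)
  also have "\<dots> = ennreal (\<Prod>b\<in>Basis. (unwo_vec u - unwo_vec l) \<bullet> b)"
    by (rule emeasure_lborel_box) (use le' in \<open>auto simp: Basis_vec_def inner_axis unwo_vec_def\<close>)
  also have "(\<Prod>b\<in>Basis. (unwo_vec u - unwo_vec l) \<bullet> b) = (\<Prod>i\<in>UNIV. (u - l) $ Abs_wo i)"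
    by (simp add: prod_Basis_cart unwo_vec_def)
  also have "\<dots> = (\<Prod>i\<in>UNIV. (u - l) $ i)"
  proof (rule prod.reindex_bij_betw)
    show "bij (Abs_wo :: 'n \<Rightarrow> _)"
      by (metis Abs_wo_inverse Rep_wo_inverse UNIV_I bijI')
  qed
  finally show "emeasure (distr lborel borel wo_vec) (box l u) = ennreal (\<Prod>b\<in>Basis. (u - l) \<bullet> b)"
    by (simp add: prod_Basis_cart)
qed simp

lemma wo_vec_image_lebesgue:
  assumes "S \<in> sets lebesgue"
  shows "(wo_vec :: real^'n \<Rightarrow> _) ` S \<in> sets lebesgue"
  by (intro differentiable_image_in_sets_lebesgue assms)
     (auto intro!: linear_imp_differentiable_on linear_wo_vec)

lemma vimage_wo_vec: "(wo_vec -` X :: ('b^'n) set) = unwo_vec ` X"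
  by (auto simp: image_iff) (metis unwo_vec_wo_vec)

lemma unwo_vec_image_lebesgue:
  assumes "X \<in> sets lebesgue"
  shows "(unwo_vec ` X :: (real^'n) set) \<in> sets lebesgue"
  by (intro differentiable_image_in_sets_lebesgue assms)
     (auto intro!: linear_imp_differentiable_on linear_wo_vec)

lemma measurable_wo_vec: "(wo_vec :: real^'n \<Rightarrow> _) \<in> measurable lebesgue lebesgue"
  by (rule measurableI) (auto simp: vimage_wo_vec unwo_vec_image_lebesgue)

text \<open>A Lebesgue set is a Borel set together with a null set;
  \<open>distr_wo_vec_lborel\<close> handles the Borel part, and the linear map
  \<open>unwo_vec\<close> sends the null part to a null set.\<close>

lemma distr_wo_vec_lebesgue: "distr lebesgue lebesgue (wo_vec :: real^'n \<Rightarrow> _) = lebesgue"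
proof (rule measure_eqI)
  fix X :: "(real^('n wo)) set"
  assume "X \<in> sets (distr lebesgue lebesgue wo_vec)"
  then have X: "X \<in> sets lebesgue" by simp
  then obtain B N where BN: "B \<in> sets borel" "negligible N" "B \<union> N = X"
    by (rule sets_lebesgue_almost_borel)
  have neg: "negligible (unwo_vec ` N :: (real^'n) set)"
    by (rule negligible_differentiable_image_negligible[OF _ BN(2)])
       (auto intro!: linear_imp_differentiable_on linear_wo_vec)
  have borel: "(wo_vec :: real^'n \<Rightarrow> _) \<in> borel_measurable borel"
    by (intro borel_measurable_continuous_onI continuous_intros)
  have "emeasure (distr lebesgue lebesgue (wo_vec :: real^'n \<Rightarrow> _)) X
      = emeasure lebesgue (unwo_vec ` X :: (real^'n) set)"
    using X by (subst emeasure_distr[OF measurable_wo_vec]) (auto simp: vimage_wo_vec)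
  also have "(unwo_vec ` X :: (real^'n) set) = unwo_vec ` B \<union> unwo_vec ` N"
    using BN by auto
  also have "emeasure lebesgue \<dots> = emeasure lebesgue (unwo_vec ` B :: (real^'n) set)"
    by (rule emeasure_Un_null_set)
       (use neg unwo_vec_image_lebesgue[of B] BN in \<open>auto simp: negligible_iff_null_sets\<close>)
  also have "\<dots> = emeasure lborel (wo_vec -` B :: (real^'n) set)"
    using BN borel measurable_sets_borel[of wo_vec borel B] by (simp add: vimage_wo_vec)
  also have "\<dots> = emeasure lebesgue B"
    using BN borel by (subst distr_wo_vec_lborel[symmetric]) (simp add: emeasure_distr)
  also have "\<dots> = emeasure lebesgue (B \<union> N)"
    by (rule emeasure_Un_null_set[symmetric]) (use BN in \<open>auto simp: negligible_iff_null_sets\<close>)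
  finally show "emeasure (distr lebesgue lebesgue (wo_vec :: real^'n \<Rightarrow> _)) X = emeasure lebesgue X"
    using BN by simp
qed simp

lemma emeasure_wo_vec_image:
  fixes S :: "(real^'n) set"
  assumes "S \<in> sets lebesgue"
  shows "emeasure lebesgue (wo_vec ` S) = emeasure lebesgue S"
proof -
  have "wo_vec -` (wo_vec ` S) = S"
    by (rule inj_vimage_image_eq) (rule bij_is_inj[OF bij_wo_vec])
  then show ?thesis
    using wo_vec_image_lebesgue[OF assms] measurable_wo_vec[where 'n = 'n]
    by (subst distr_wo_vec_lebesgue[symmetric]) (simp add: emeasure_distr)
qed

text \<open>Conjugation by \<open>f\<close> is a sign-preserving bijection between the permutations
  of the two index types, so the two Leibniz sums agree term by term.\<close>

lemma det_reindex:
  fixes A :: "'b::comm_ring_1^'n^'n" and f :: "'m::finite \<Rightarrow> 'n"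
  assumes "bij f"
  shows "det (\<chi> i j. A $ f i $ f j) = det A"
proof -
  have inj: "inj f"
    using assms by (rule bij_is_inj)
  have rw: "map_permutation UNIV f p = (\<lambda>x. f (p (inv f x)))" for p
    using assms by (auto simp: map_permutation_def bij_is_surj restrict_id_def fun_eq_iff)
  have "det A = (\<Sum>p | p permutes (UNIV :: 'n set). of_int (sign p) * (\<Prod>i\<in>UNIV. A $ i $ p i))"
    by (simp add: det_def)
  also have "\<dots> = (\<Sum>p | p permutes (UNIV :: 'm set).
      of_int (sign (\<lambda>x. f (p (inv f x)))) * (\<Prod>i\<in>UNIV. A $ i $ f (p (inv f i))))"
    using bij_betw_permutations[OF assms]
    by (subst sum.reindex_bij_betw[symmetric]) auto
  also have "\<dots> = (\<Sum>p | p permutes (UNIV :: 'm set). of_int (sign p) * (\<Prod>i\<in>UNIV. A $ f i $ f (p i)))"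
  proof (intro sum.cong refl arg_cong2[where f = "(*)"] arg_cong[where f = of_int])
    fix p :: "'m \<Rightarrow> 'm" assume "p \<in> {p. p permutes UNIV}"
    then show "sign (\<lambda>x. f (p (inv f x))) = sign p"
      using sign_map_permutation[OF inj, of p] by (simp add: rw)
    show "(\<Prod>i\<in>UNIV. A $ i $ f (p (inv f i))) = (\<Prod>i\<in>UNIV. A $ f i $ f (p i))"
      using inj by (subst prod.reindex_bij_betw[OF assms, symmetric]) simp
  qed
  finally show ?thesis
    by (simp add: det_def)
qed

text \<open>The extended-real form includes infinite measure: the image has finite measure exactly
  when the Jacobian is integrable, so otherwise both sides are infinite.\<close>

lemma emeasure_differentiable_image_wellorder:
  fixes f :: "real^'n::{finite,wellorder} \<Rightarrow> real^'n::_"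
  assumes S: "S \<in> sets lebesgue"
    and der: "\<And>x. x \<in> S \<Longrightarrow> (f has_derivative f' x) (at x within S)"
    and inj: "inj_on f S"
  shows "emeasure lebesgue (f ` S) = (\<integral>\<^sup>+x. ennreal \<bar>det (matrix (f' x))\<bar> \<partial>lebesgue_on S)"
proof (cases "f ` S \<in> lmeasurable")
  case True
  then have "((\<lambda>x. \<bar>det (matrix (f' x))\<bar>) has_integral measure lebesgue (f ` S)) S"
    using has_measure_differentiable_image[OF S der inj] by blast
  from nn_integral_has_integral_lebesgue[OF _ this]
  have "(\<integral>\<^sup>+x. ennreal \<bar>det (matrix (f' x))\<bar> \<partial>lebesgue_on S) = ennreal (measure lebesgue (f ` S))"
    using S by (simp add: nn_integral_restrict_space nn_integral_completion ennreal_mult' ennreal_indicator mult.commute)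
  then show ?thesis
    using True by (simp add: emeasure_eq_measure2)
next
  case False
  have im: "f ` S \<in> sets lebesgue"
    using der by (intro differentiable_image_in_sets_lebesgue S) (auto simp: differentiable_on_def differentiable_def)
  with False have "emeasure lebesgue (f ` S) = \<infinity>"
    unfolding fmeasurable_def by (metis (mono_tags) infinity_ennreal_def mem_Collect_eq top.not_eq_extremum)
  moreover have "(\<integral>\<^sup>+x. ennreal \<bar>det (matrix (f' x))\<bar> \<partial>lebesgue_on S) = \<infinity>"
  proof (rule ccontr)
    assume "(\<integral>\<^sup>+x. ennreal \<bar>det (matrix (f' x))\<bar> \<partial>lebesgue_on S) \<noteq> \<infinity>"
    then have "integrable (lebesgue_on S) (\<lambda>x. \<bar>det (matrix (f' x))\<bar>)"
      using borel_measurable_det_Jacobian[OF S der]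
      by (intro integrableI_bounded) (auto simp: less_top)
    then have "(\<lambda>x. \<bar>det (matrix (f' x))\<bar>) integrable_on S"
      using S by (rule integrable_on_lebesgue_on)
    then show False
      using False measurable_differentiable_image_eq[OF S der inj] by blast
  qed
  ultimately show ?thesis by simp
qed

section \<open>Transfer of change of variables and of Sard's theorem along
  \<open>wo_vec\<close>\<close>

definition wo_conj :: "(real^'n \<Rightarrow> real^'n) \<Rightarrow> real^('n wo) \<Rightarrow> real^('n wo)" where
  "wo_conj f y = wo_vec (f (unwo_vec y))"

lemma wo_conj_image: "wo_conj f ` wo_vec ` S = wo_vec ` f ` S"
  by (simp add: wo_conj_def image_image)

lemma det_wo_conj: "det (matrix (wo_conj L)) = det (matrix L)"
proof -
  have ax: "unwo_vec (axis j c) = axis (Rep_wo j) c" for j and c :: real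
    by (auto simp: unwo_vec_def axis_def vec_eq_iff Abs_wo_inverse Rep_wo_inverse)
  have "matrix (wo_conj L) = (\<chi> i j. matrix L $ Rep_wo i $ Rep_wo j)"
    by (auto simp: matrix_def vec_eq_iff wo_conj_def ax) (simp add: wo_vec_def)
  then show ?thesis
    by (simp add: det_reindex bij_Rep_wo)
qed

lemma has_derivative_wo_conj:
  assumes der: "\<And>x. x \<in> S \<Longrightarrow> (f has_derivative f' x) (at x within S)"
    and y: "y \<in> wo_vec ` S"
  shows "(wo_conj f has_derivative wo_conj (f' (unwo_vec y))) (at y within wo_vec ` S)"
proof -
  obtain x where x: "x \<in> S" "y = wo_vec x" using y by auto
  have im: "unwo_vec ` wo_vec ` S = S"
    by (simp add: image_image)
  have unwo: "(unwo_vec has_derivative unwo_vec) (at y within wo_vec ` S)"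
    by (simp add: linear_imp_has_derivative linear_wo_vec)
  have "(f has_derivative f' x) (at (unwo_vec y) within unwo_vec ` wo_vec ` S)"
    using der[OF x(1)] by (simp add: im x)
  from diff_chain_within[OF unwo this]
  have "(f \<circ> unwo_vec has_derivative f' x \<circ> unwo_vec) (at y within wo_vec ` S)" .
  from diff_chain_within[OF this linear_imp_has_derivative[OF linear_wo_vec(1)]]
  show ?thesis
    by (simp add: wo_conj_def[abs_def] o_def x)
qed

lemma measurable_wo_vec_lebesgue_on:
  "(wo_vec :: real^'n \<Rightarrow> _) \<in> measurable (lebesgue_on S) (lebesgue_on (wo_vec ` S))"
  by (intro measurable_restrict_space3 measurable_wo_vec) auto

lemma borel_measurable_det_jacobian:
  fixes f :: "real^'n \<Rightarrow> real^'n"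
  assumes S: "S \<in> sets lebesgue"
    and der: "\<And>x. x \<in> S \<Longrightarrow> (f has_derivative f' x) (at x within S)"
  shows "(\<lambda>x. det (matrix (f' x))) \<in> borel_measurable (lebesgue_on S)"
proof -
  have "(\<lambda>y. det (matrix (wo_conj (f' (unwo_vec y))))) \<in> borel_measurable (lebesgue_on (wo_vec ` S))"
    by (rule borel_measurable_det_Jacobian[OF wo_vec_image_lebesgue[OF S] has_derivative_wo_conj[OF der]])
  from measurable_compose[OF measurable_wo_vec_lebesgue_on this] show ?thesis
    by (simp add: det_wo_conj)
qed

lemma emeasure_differentiable_image:
  fixes f :: "real^'n \<Rightarrow> real^'n"
  assumes S: "S \<in> sets lebesgue"
    and der: "\<And>x. x \<in> S \<Longrightarrow> (f has_derivative f' x) (at x within S)"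
    and inj: "inj_on f S"
  shows "emeasure lebesgue (f ` S) = (\<integral>\<^sup>+x. ennreal \<bar>det (matrix (f' x))\<bar> \<partial>lebesgue_on S)"
proof -
  let ?W = "wo_vec ` S"
  let ?D = "\<lambda>y. \<bar>det (matrix (f' (unwo_vec y)))\<bar>"
  have W: "?W \<in> sets lebesgue" by (rule wo_vec_image_lebesgue[OF S])
  have inj': "inj_on (wo_conj f) ?W"
  proof (rule inj_onI)
    fix y z assume "y \<in> ?W" "z \<in> ?W" and eq: "wo_conj f y = wo_conj f z"
    then obtain a b where ab: "a \<in> S" "b \<in> S" "y = wo_vec a" "z = wo_vec b" by auto
    have "unwo_vec (wo_conj f y) = unwo_vec (wo_conj f z)"
      by (simp only: eq)
    then show "y = z"
      using ab inj by (simp add: wo_conj_def inj_on_eq_iff)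
  qed
  have fS: "f ` S \<in> sets lebesgue"
    using der by (intro differentiable_image_in_sets_lebesgue S) (auto simp: differentiable_on_def differentiable_def)
  have D: "?D \<in> borel_measurable (lebesgue_on ?W)"
    using borel_measurable_det_Jacobian[OF W has_derivative_wo_conj[OF der]]
    unfolding det_wo_conj by (rule borel_measurable_abs)
  have meas: "(\<lambda>y. ennreal (?D y) * indicator ?W y) \<in> borel_measurable lebesgue"
  proof (rule iffD1[OF borel_measurable_restrict_space_iff_ennreal])
    show "?W \<inter> space lebesgue \<in> sets lebesgue" using W by simp
    show "(\<lambda>y. ennreal (?D y)) \<in> borel_measurable (lebesgue_on ?W)"
      by (rule measurable_compose[OF D measurable_ennreal])
  qed
  have "emeasure lebesgue (f ` S) = emeasure lebesgue (wo_conj f ` ?W)"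
    by (simp add: wo_conj_image emeasure_wo_vec_image fS)
  also have "\<dots> = (\<integral>\<^sup>+y. ennreal (?D y) \<partial>lebesgue_on ?W)"
    using emeasure_differentiable_image_wellorder[OF W has_derivative_wo_conj[OF der] inj']
    by (simp add: det_wo_conj)
  \<comment> \<open>Extended by zero, the integrand lives on the whole space, where
    \<open>wo_vec\<close> preserves Lebesgue measure.\<close>
  also have "\<dots> = (\<integral>\<^sup>+y. ennreal (?D y) * indicator ?W y \<partial>lebesgue)"
    using W by (simp add: nn_integral_restrict_space)
  also have "\<dots> = (\<integral>\<^sup>+y. ennreal (?D y) * indicator ?W y \<partial>distr lebesgue lebesgue (wo_vec :: real^'n \<Rightarrow> _))"
    by (simp add: distr_wo_vec_lebesgue)
  also have "\<dots> = (\<integral>\<^sup>+x. ennreal (?D (wo_vec x)) * indicator ?W (wo_vec x) \<partial>lebesgue)"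
    by (rule nn_integral_distr[OF measurable_wo_vec]) (use meas in \<open>simp add: distr_wo_vec_lebesgue\<close>)
  also have "\<dots> = (\<integral>\<^sup>+x. ennreal \<bar>det (matrix (f' x))\<bar> * indicator S x \<partial>lebesgue)"
    by (intro nn_integral_cong) (auto simp: indicator_def inj_image_mem_iff bij_is_inj[OF bij_wo_vec])
  also have "\<dots> = (\<integral>\<^sup>+x. ennreal \<bar>det (matrix (f' x))\<bar> \<partial>lebesgue_on S)"
    using S by (simp add: nn_integral_restrict_space)
  finally show ?thesis .
qed

lemma Sard_det_0:
  fixes f :: "real^'n \<Rightarrow> real^'n"
  assumes der: "\<And>x. x \<in> S \<Longrightarrow> (f has_derivative f' x) (at x within S)"
    and det: "\<And>x. x \<in> S \<Longrightarrow> det (matrix (f' x)) = 0"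
  shows "negligible (f ` S)"
proof -
  have "rank (matrix (wo_conj (f' (unwo_vec y)))) < CARD('n wo)" if "y \<in> wo_vec ` S" for y
    using that by (subst det_eq_0_rank[symmetric]) (auto simp: det_wo_conj det)
  then have neg: "negligible (wo_conj f ` wo_vec ` S)"
    using baby_Sard[OF order_refl has_derivative_wo_conj[OF der]] by blast
  have "negligible (unwo_vec ` wo_conj f ` wo_vec ` S :: (real^'n) set)"
    by (rule negligible_differentiable_image_negligible[OF _ neg])
       (auto intro!: linear_imp_differentiable_on linear_wo_vec)
  then show ?thesis
    by (simp add: wo_conj_def image_image)
qed

subsection \<open>Lebesgue density\<close>

lemma lmeasurable_Int_ball: "E \<in> sets lebesgue \<Longrightarrow> E \<inter> ball x r \<in> lmeasurable"
  by (meson bounded_Int bounded_ball bounded_set_imp_lmeasurable lmeasurable_ball fmeasurableD sets.Int)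

text \<open>A Vitali argument. Let T be an open superset of S with |T - S| < c e. The balls inside T
  of which more than the share c lies outside S cover the bad set finely, so countably many disjoint
  ones cover it up to a null set. Their parts outside S are disjoint subsets of T - S, so the balls
  have total measure at most |T - S| / c < e.\<close>

lemma negligible_density_defect:
  fixes S :: "'a::euclidean_space set"
  assumes S: "S \<in> sets lebesgue" and c: "0 < c"
  shows "negligible {x \<in> S. \<forall>d>0. \<exists>r. 0 < r \<and> r < d \<and>
      c * measure lebesgue (ball x r) < measure lebesgue (ball x r - S)}" (is "negligible ?F")
  unfolding negligible_outer_le
proof (intro allI impI)
  fix e :: real assume "0 < e"
  then have "0 < c * e" using c by simp
  then obtain T where T: "open T" "S \<subseteq> T" "T - S \<in> lmeasurable"
    "emeasure lebesgue (T - S) < ennreal (c * e)"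
    by (rule sets_lebesgue_outer_open[OF S])
  define K where "K = {i :: 'a \<times> real. 0 < snd i \<and> ball (fst i) (snd i) \<subseteq> T \<and>
    c * measure lebesgue (ball (fst i) (snd i)) < measure lebesgue (ball (fst i) (snd i) - S)}"
  have "\<exists>i. i \<in> K \<and> x \<in> ball (fst i) (snd i) \<and> snd i < d" if x: "x \<in> ?F" and d: "0 < d" for x d
  proof -
    have "x \<in> T" using x T by blast
    with T(1) obtain d' where d': "d' > 0" "ball x d' \<subseteq> T"
      by (rule openE)
    then have "0 < min d d'" using d by simp
    with x obtain r where r: "0 < r" "r < min d d'"
      "c * measure lebesgue (ball x r) < measure lebesgue (ball x r - S)"
      by blast
    then have "ball x r \<subseteq> ball x d'"
      by (intro subset_ball) simp
    with d' have "ball x r \<subseteq> T" by blast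
    then show ?thesis
      using r by (intro exI[of _ "(x, r)"]) (auto simp: K_def)
  qed
  then obtain C where C: "countable C" "C \<subseteq> K"
     "pairwise (\<lambda>i j. disjnt (ball (fst i) (snd i)) (ball (fst j) (snd j))) C"
     "negligible (?F - (\<Union>i\<in>C. ball (fst i) (snd i)))"
    by (rule Vitali_covering_theorem_balls)
  let ?B = "\<lambda>i :: 'a \<times> real. ball (fst i) (snd i)"
  let ?W = "\<Union>i\<in>C. ?B i"
  have disj1: "disjoint_family_on ?B C"
    using C(3) by (simp add: disjoint_family_on_def pairwise_def disjnt_def)
  then have disj: "disjoint_family_on ?B C" "disjoint_family_on (\<lambda>i. ?B i - S) C"
    unfolding disjoint_family_on_def by blast+
  have "?W \<in> sets borel"
    by (intro borel_open open_UN ballI open_ball)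
  then have W: "?W \<in> sets lebesgue"
    by simp
  have "ennreal c * emeasure lebesgue ?W = (\<integral>\<^sup>+i. ennreal c * emeasure lebesgue (?B i) \<partial>count_space C)"
    using C disj by (subst emeasure_UN_countable) (auto simp: nn_integral_cmult)
  also have "\<dots> \<le> (\<integral>\<^sup>+i. emeasure lebesgue (?B i - S) \<partial>count_space C)"
  proof (intro nn_integral_mono)
    fix i assume "i \<in> space (count_space C)"
    then have "i \<in> K" using C by auto
      moreover have "?B i \<in> lmeasurable" by simp
    moreover from this have "?B i - S \<in> lmeasurable"
      using S by (simp add: fmeasurable_Diff)
    ultimately show "ennreal c * emeasure lebesgue (?B i) \<le> emeasure lebesgue (?B i - S)"
      using c by (auto simp: K_def emeasure_eq_measure2 ennreal_mult'[symmetric] less_imp_le intro!: ennreal_leI)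
  qed
  also have "\<dots> = emeasure lebesgue (\<Union>i\<in>C. ?B i - S)"
    using C S disj by (subst emeasure_UN_countable) auto
  also have "\<dots> \<le> emeasure lebesgue (T - S)"
    using C T by (intro emeasure_mono) (auto simp: K_def)
  also have "\<dots> < ennreal c * ennreal e"
    using T c \<open>0 < e\<close> by (simp add: ennreal_mult')
  finally have "emeasure lebesgue ?W < ennreal e"
    using c by (metis ennreal_mult_strict_left_mono linorder_not_less mult_left_mono zero_le)
  then have Wm: "?W \<in> lmeasurable" "measure lebesgue ?W \<le> e"
    using W \<open>0 < e\<close> by (auto simp: fmeasurable_def order.strict_trans measure_def intro!: enn2real_leI)
  let ?T = "?W \<union> (?F - ?W)"
  have "?T \<in> lmeasurable"
    by (rule fmeasurable.Un[OF Wm(1) negligible_imp_measurable[OF C(4)]])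
  moreover have "measure lebesgue ?T \<le> measure lebesgue ?W + measure lebesgue (?F - ?W)"
    using W negligible_imp_sets[OF C(4)] by (rule measure_Un_le)
  moreover have "measure lebesgue (?F - ?W) = 0"
    using C(4) by (rule negligible_imp_measure0)
  ultimately show "\<exists>T. ?F \<subseteq> T \<and> T \<in> lmeasurable \<and> measure lebesgue T \<le> e"
    using Wm by (intro exI[of _ ?T]) auto
qed

lemma density_ratio_mono:
  assumes "E \<subseteq> F" "E \<in> sets lebesgue" "F \<in> sets lebesgue"
  shows "measure lebesgue (E \<inter> ball x r) / measure lebesgue (ball x r)
    \<le> measure lebesgue (F \<inter> ball x r) / measure lebesgue (ball x r)"
  using assms by (intro divide_right_mono measure_mono_fmeasurable lmeasurable_Int_ball) auto

lemma density_ratio_le_1: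
  assumes "E \<in> sets lebesgue"
  shows "measure lebesgue (E \<inter> ball x r) / measure lebesgue (ball x r) \<le> 1"
proof -
  have "measure lebesgue (E \<inter> ball x r) \<le> measure lebesgue (ball x r)"
    using assms by (intro measure_mono_fmeasurable) auto
  then show ?thesis
    using measure_nonneg[of lebesgue "ball x r"] by (auto simp: divide_le_eq_1)
qed

text \<open>The Lebesgue density theorem: outside the bad sets of
  \<open>negligible_density_defect\<close> for the countably many shares 1/(n+1), the part of a
  small ball outside S is an arbitrarily small share of it.\<close>

lemma negligible_not_density_1:
  fixes S :: "'a::euclidean_space set"
  assumes S: "S \<in> sets lebesgue"
  shows "negligible {x \<in> S. \<not> has_lebesgue_density S x 1}"
proof (rule negligible_subset)
  let ?F = "\<lambda>c. {x \<in> S. \<forall>d>0. \<exists>r. 0 < r \<and> r < d \<and>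
      c * measure lebesgue (ball x r) < measure lebesgue (ball x r - S)}"
  show "negligible (\<Union>n. ?F (1 / real (Suc n)))"
  proof (rule negligible_countable_Union)
    fix N assume "N \<in> range (\<lambda>n. ?F (1 / real (Suc n)))"
    then obtain n where "N = ?F (1 / real (Suc n))" by blast
    then show "negligible N"
      using negligible_density_defect[OF S, of "1 / real (Suc n)"] by simp
  qed simp
  show "{x \<in> S. \<not> has_lebesgue_density S x 1} \<subseteq> (\<Union>n. ?F (1 / real (Suc n)))"
  proof (rule subsetI, rule ccontr)
    fix x assume x: "x \<in> {x \<in> S. \<not> has_lebesgue_density S x 1}"
      and nx: "x \<notin> (\<Union>n. ?F (1 / real (Suc n)))"
    have "((\<lambda>r. measure lebesgue (S \<inter> ball x r) / measure lebesgue (ball x r)) \<longlongrightarrow> 1) (at_right 0)"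
    proof (rule tendstoI)
      fix e :: real assume "0 < e"
      then obtain n where n: "1 / real (Suc n) < e"
        by (metis nat_approx_posE)
      obtain d where d: "d > 0" and "\<not> (\<exists>r. 0 < r \<and> r < d \<and>
          1 / real (Suc n) * measure lebesgue (ball x r) < measure lebesgue (ball x r - S))"
        using x nx by blast
      then have le: "measure lebesgue (ball x r - S) \<le> 1 / real (Suc n) * measure lebesgue (ball x r)"
        if "0 < r" "r < d" for r
        using that by (meson linorder_not_less)
      have "dist (measure lebesgue (S \<inter> ball x r) / measure lebesgue (ball x r)) 1 < e"
        if "0 < r" "r < d" for r
      proof -
        have pos: "0 < measure lebesgue (ball x r)"
          using that by (simp add: content_ball_pos)
        have "measure lebesgue (ball x r - S) = measure lebesgue (ball x r) - measure lebesgue (S \<inter> ball x r)"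
          using measure_Diff[of lebesgue "ball x r" "S \<inter> ball x r"] S emeasure_lborel_ball_finite[of x r]
            fmeasurableD[OF lmeasurable_Int_ball[OF S]]
          by (simp add: Diff_Int)
        then have "(1 - 1 / real (Suc n)) * measure lebesgue (ball x r) \<le> measure lebesgue (S \<inter> ball x r)"
          using le[OF that] by (simp add: algebra_simps del: of_nat_Suc)
        then have "1 - 1 / real (Suc n) \<le> measure lebesgue (S \<inter> ball x r) / measure lebesgue (ball x r)"
          using pos by (simp add: pos_le_divide_eq)
        with n density_ratio_le_1[OF S, of x r] show ?thesis
          by (simp add: dist_real_def)
      qed
      then show "\<forall>\<^sub>F r in at_right 0. dist (measure lebesgue (S \<inter> ball x r) / measure lebesgue (ball x r)) 1 < e"
        using d by (auto simp: eventually_at_right_field)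
    qed
    with S x show False
      by (simp add: has_lebesgue_density_def)
  qed
qed

section \<open>Consequences of density 1\<close>

lemma has_lebesgue_density_1_mono:
  assumes "S \<subseteq> A" "A \<in> sets lebesgue" "has_lebesgue_density S x 1"
  shows "has_lebesgue_density A x 1"
proof -
  have S: "S \<in> sets lebesgue"
    and lim: "((\<lambda>r. measure lebesgue (S \<inter> ball x r) / measure lebesgue (ball x r)) \<longlongrightarrow> 1) (at_right 0)"
    using assms by (auto simp: has_lebesgue_density_def)
  show ?thesis
    unfolding has_lebesgue_density_def
  proof (intro conjI assms tendsto_sandwich[OF _ _ lim tendsto_const])
    show "\<forall>\<^sub>F r in at_right 0. measure lebesgue (S \<inter> ball x r) / measure lebesgue (ball x r)
        \<le> measure lebesgue (A \<inter> ball x r) / measure lebesgue (ball x r)"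
      using density_ratio_mono[OF assms(1) S assms(2)] by simp
    show "\<forall>\<^sub>F r in at_right 0. measure lebesgue (A \<inter> ball x r) / measure lebesgue (ball x r) \<le> 1"
      using density_ratio_le_1[OF assms(2)] by simp
  qed
qed

text \<open>In small balls E lies in the complement of S, so its share of the ball is at most one
  minus the share of S.\<close>

lemma has_lebesgue_density_0_disjoint:
  assumes "has_lebesgue_density S x 1" "E \<in> sets lebesgue" "0 < d" "E \<inter> S \<inter> ball x d = {}"
  shows "has_lebesgue_density E x 0"
proof -
  have S: "S \<in> sets lebesgue"
    and lim: "((\<lambda>r. measure lebesgue (S \<inter> ball x r) / measure lebesgue (ball x r)) \<longlongrightarrow> 1) (at_right 0)"
    using assms by (auto simp: has_lebesgue_density_def)
  have lim': "((\<lambda>r. 1 - measure lebesgue (S \<inter> ball x r) / measure lebesgue (ball x r)) \<longlongrightarrow> 0) (at_right 0)"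
    using tendsto_diff[OF tendsto_const[of 1] lim] by simp
  have "measure lebesgue (E \<inter> ball x r) / measure lebesgue (ball x r)
      \<le> 1 - measure lebesgue (S \<inter> ball x r) / measure lebesgue (ball x r)" if r: "0 < r" "r < d" for r
  proof -
    have pos: "0 < measure lebesgue (ball x r)"
      using r by (simp add: content_ball_pos)
    have "(E \<inter> ball x r) \<inter> (S \<inter> ball x r) = {}"
      using assms(4) r by fastforce
    then have "measure lebesgue (E \<inter> ball x r) + measure lebesgue (S \<inter> ball x r)
        = measure lebesgue ((E \<inter> ball x r) \<union> (S \<inter> ball x r))"
      using S assms fmeasurableD2[OF lmeasurable_Int_ball[OF S]] fmeasurableD2[OF lmeasurable_Int_ball[OF assms(2)]]
      by (intro measure_Union[symmetric] sets.Int) simp_all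
    also have "\<dots> \<le> measure lebesgue (ball x r)"
      using assms S by (intro measure_mono_fmeasurable sets.Un sets.Int) auto
    finally show ?thesis
      using pos by (simp add: field_simps)
  qed
  then have "\<forall>\<^sub>F r in at_right 0. measure lebesgue (E \<inter> ball x r) / measure lebesgue (ball x r)
      \<le> 1 - measure lebesgue (S \<inter> ball x r) / measure lebesgue (ball x r)"
    using assms(3) by (auto simp: eventually_at_right_field)
  then show ?thesis
    using assms(2) unfolding has_lebesgue_density_def
    by (intro conjI tendsto_sandwich[OF _ _ tendsto_const lim']) auto
qed

text \<open>With r = |y - x|, the ball of radius c r about y takes up the fixed share (c/2)^n of the
  ball of radius 2 r about x. If S missed it, the share of S there could not approach 1.\<close>

lemma density_1_near:
  fixes S :: "'a::euclidean_space set"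
  assumes dens: "has_lebesgue_density S x 1" and e: "0 < e"
  obtains d where "0 < d" "\<And>y. norm (y - x) < d \<Longrightarrow> y \<noteq> x \<Longrightarrow> \<exists>q\<in>S. norm (q - y) \<le> e * norm (y - x)"
proof -
  \<comment> \<open>The cap at 1 keeps \<open>ball y (c * r)\<close> inside
    \<open>ball x (2 * r)\<close>.\<close>
  define c where "c = min e 1"
  let ?n = "DIM('a)"
  have c: "0 < c" "c \<le> 1" "c \<le> e" using e by (auto simp: c_def)
  have S: "S \<in> sets lebesgue"
    and lim: "((\<lambda>r. measure lebesgue (S \<inter> ball x r) / measure lebesgue (ball x r)) \<longlongrightarrow> 1) (at_right 0)"
    using assms by (auto simp: has_lebesgue_density_def)
  have "\<forall>\<^sub>F r in at_right 0. 1 - (c/2)^?n < measure lebesgue (S \<inter> ball x r) / measure lebesgue (ball x r)"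
    using c by (intro order_tendstoD(1)[OF lim]) auto
  then obtain b where b: "0 < b" and near: "\<And>r. 0 < r \<Longrightarrow> r < b \<Longrightarrow>
      1 - (c/2)^?n < measure lebesgue (S \<inter> ball x r) / measure lebesgue (ball x r)"
    by (auto simp: eventually_at_right_field)
  show thesis
  proof
    show "0 < b / 2" using b by simp
    fix y assume y: "norm (y - x) < b / 2" "y \<noteq> x"
    define r where "r = norm (y - x)"
    have r: "0 < r" "2 * r < b" using y by (auto simp: r_def)
    show "\<exists>q\<in>S. norm (q - y) \<le> e * norm (y - x)"
    proof (rule ccontr)
      assume far: "\<not> (\<exists>q\<in>S. norm (q - y) \<le> e * norm (y - x))"
      let ?u = "measure lebesgue (ball (0::'a) 1)"
      have pos: "0 < measure lebesgue (ball x (2 * r))"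
        using r by (simp add: content_ball_pos)
      have sub: "ball y (c * r) \<subseteq> ball x (2 * r)"
      proof
        fix z assume "z \<in> ball y (c * r)"
        moreover have "c * r \<le> r" using c r by (simp add: mult_left_le_one_le)
        moreover have "dist x z \<le> dist x y + dist y z" by (rule dist_triangle)
        ultimately show "z \<in> ball x (2 * r)"
          by (simp add: r_def dist_norm norm_minus_commute)
      qed
      have "S \<inter> ball x (2 * r) \<subseteq> ball x (2 * r) - ball y (c * r)"
      proof safe
        fix z assume "z \<in> S" "z \<in> ball y (c * r)"
        moreover have "c * r \<le> e * r" using c r by simp
        ultimately show False
          using far by (force simp: r_def dist_norm norm_minus_commute)
      qed
      then have "measure lebesgue (S \<inter> ball x (2 * r)) \<le> measure lebesgue (ball x (2 * r) - ball y (c * r))"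
        using S by (intro measure_mono_fmeasurable) (auto intro: fmeasurable.Diff)
      also have "\<dots> = measure lebesgue (ball x (2 * r)) - measure lebesgue (ball y (c * r))"
        using sub emeasure_lborel_ball_finite[of x "2 * r"] by (intro measure_Diff) auto
      also have "measure lebesgue (ball y (c * r)) = (c * r)^?n * ?u"
        using content_ball_conv_unit_ball[of "c * r" y] c r by simp
      also have "\<dots> = (c/2)^?n * ((2 * r)^?n * ?u)"
        by (simp add: power_mult_distrib power_divide)
      also have "(2 * r)^?n * ?u = measure lebesgue (ball x (2 * r))"
        using content_ball_conv_unit_ball[of "2 * r" x] r by simp
      finally have "measure lebesgue (S \<inter> ball x (2 * r)) \<le> (1 - (c/2)^?n) * measure lebesgue (ball x (2 * r))"
        by (simp add: algebra_simps)
      then have "measure lebesgue (S \<inter> ball x (2 * r)) / measure lebesgue (ball x (2 * r)) \<le> 1 - (c/2)^?n"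
        using pos by (simp add: pos_divide_le_eq)
      with near[of "2 * r"] r show False by simp
    qed
  qed
qed

subsection \<open>Differentiability of Lipschitz functions on the real line\<close>

text \<open>Vitali's theorem picks disjoint short intervals [a, b] of slope at most p that cover E
  up to a null set, whose Lipschitz image is null. By monotonicity their images lie in the disjoint
  intervals [g a, g b], of length at most p (b - a). Confining the intervals to an open T with |T -
  E| < e/p costs only e.\<close>

lemma emeasure_image_le_slope:
  fixes g :: "real \<Rightarrow> real"
  assumes mono: "strict_mono g" and lip: "L-lipschitz_on UNIV g"
    and E: "E \<in> sets lebesgue" and p: "0 < p"
    and small: "\<And>x d. x \<in> E \<Longrightarrow> 0 < d \<Longrightarrow>
      \<exists>a b. a < b \<and> a \<le> x \<and> x \<le> b \<and> b - a < d \<and> g b - g a \<le> p * (b - a)"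
  shows "emeasure lebesgue (g ` E) \<le> ennreal p * emeasure lebesgue E"
proof (rule ennreal_le_epsilon)
  fix e :: real assume e: "0 < e"
  then have "0 < e / p" using p by simp
  then obtain T where T: "open T" "E \<subseteq> T" "T - E \<in> lmeasurable"
    "emeasure lebesgue (T - E) < ennreal (e / p)"
    by (rule sets_lebesgue_outer_open[OF E])
  define K where "K = {(a, b). a < b \<and> {a..b} \<subseteq> T \<and> g b - g a \<le> p * (b - a)}"
  \<comment> \<open>Midpoint and half-length present the interval as a closed ball, the shape the
    covering theorem uses.\<close>
  let ?m = "\<lambda>i::real \<times> real. (fst i + snd i) / 2" and ?r = "\<lambda>i::real \<times> real. (snd i - fst i) / 2"
  have cb: "cball (?m i) (?r i) = {fst i..snd i}" for i
    by (simp add: cball_eq_atLeastAtMost field_simps)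
  have Vitali: "\<exists>i. i \<in> K \<and> x \<in> cball (?m i) (?r i) \<and> ?r i < d" if x: "x \<in> E" and d: "0 < d" for x d
  proof -
    have "x \<in> T" using x T by blast
    with T(1) obtain d' where d': "d' > 0" "ball x d' \<subseteq> T"
      by (rule openE)
    then have "0 < min d d'" using d by simp
    with x obtain a b where ab: "a < b" "a \<le> x" "x \<le> b" "b - a < min d d'" "g b - g a \<le> p * (b - a)"
      using small by blast
    have "{a..b} \<subseteq> ball x d'"
      using ab by (auto simp: dist_real_def)
    with d' have "{a..b} \<subseteq> T" by blast
    then show ?thesis
      using ab unfolding cb by (intro exI[of _ "(a, b)"]) (auto simp: K_def)
  qed
  have "0 < ?r i" if "i \<in> K" for i
    using that by (auto simp: K_def)
  from Vitali_covering_theorem_cballs[of K ?r E ?m, OF this Vitali]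
  obtain C where "countable C" "C \<subseteq> K"
     "pairwise (\<lambda>i j. disjnt (cball (?m i) (?r i)) (cball (?m j) (?r j))) C"
     "negligible (E - (\<Union>i\<in>C. cball (?m i) (?r i)))"
    by blast
  note C = this[unfolded cb]
  let ?W = "\<Union>i\<in>C. {fst i..snd i}"
  have disj: "disjoint_family_on (\<lambda>i. {fst i..snd i}) C"
    using C(3) by (simp add: disjoint_family_on_def pairwise_def disjnt_def)
  have disj': "disjoint_family_on (\<lambda>i. {g (fst i)..g (snd i)}) C"
    unfolding disjoint_family_on_def
  proof (intro ballI impI)
    fix i j assume ij: "i \<in> C" "j \<in> C" "i \<noteq> j"
    then have "{fst i..snd i} \<inter> {fst j..snd j} = {}"
      using disj by (simp add: disjoint_family_on_def)
    moreover have "fst i < snd i" "fst j < snd j"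
      using ij C(2) by (auto simp: K_def)
    ultimately have "snd i < fst j \<or> snd j < fst i"
      by (auto simp: Int_atLeastAtMost)
    then have "g (snd i) < g (fst j) \<or> g (snd j) < g (fst i)"
      using mono by (auto simp: strict_mono_def)
    then show "{g (fst i)..g (snd i)} \<inter> {g (fst j)..g (snd j)} = {}"
      by auto
  qed
  have neg: "negligible (g ` (E - ?W))"
  proof (rule negligible_locally_Lipschitz_image[OF _ C(4)])
    fix x
    have "norm (g y - g x) \<le> L * norm (y - x)" for y
      using lipschitz_on_normD[OF lip] by simp
    then show "\<exists>T B. open T \<and> x \<in> T \<and> (\<forall>y\<in>(E - ?W) \<inter> T. norm (g y - g x) \<le> B * norm (y - x))"
      by (intro exI[of _ UNIV] exI[of _ L]) auto
  qed simp
  have "g ` E \<subseteq> (\<Union>i\<in>C. {g (fst i)..g (snd i)}) \<union> g ` (E - ?W)"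
  proof
    fix y assume "y \<in> g ` E"
    then obtain x where x: "x \<in> E" "y = g x" by blast
    show "y \<in> (\<Union>i\<in>C. {g (fst i)..g (snd i)}) \<union> g ` (E - ?W)"
    proof (cases "x \<in> ?W")
      case True
      then obtain i where "i \<in> C" "fst i \<le> x" "x \<le> snd i" by auto
      then have "i \<in> C" "y \<in> {g (fst i)..g (snd i)}"
        using mono x by (simp_all add: strict_mono_less_eq)
      then show ?thesis by blast
    next
      case False
      then show ?thesis using x by blast
    qed
  qed
  then have "emeasure lebesgue (g ` E) \<le> emeasure lebesgue ((\<Union>i\<in>C. {g (fst i)..g (snd i)}) \<union> g ` (E - ?W))"
    using C(1) neg by (intro emeasure_mono sets.Un sets.countable_UN' negligible_imp_sets) auto
  also have "\<dots> = emeasure lebesgue (\<Union>i\<in>C. {g (fst i)..g (snd i)})"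
    using neg C(1) by (intro emeasure_Un_null_set sets.countable_UN') (auto simp: negligible_iff_null_sets)
  also have "\<dots> = (\<integral>\<^sup>+i. emeasure lebesgue {g (fst i)..g (snd i)} \<partial>count_space C)"
    using C(1) disj' by (intro emeasure_UN_countable) auto
  also have "\<dots> \<le> (\<integral>\<^sup>+i. ennreal p * emeasure lebesgue {fst i..snd i} \<partial>count_space C)"
  proof (intro nn_integral_mono)
    fix i assume "i \<in> space (count_space C)"
    then have "fst i < snd i" "g (snd i) - g (fst i) \<le> p * (snd i - fst i)"
      using C(2) by (auto simp: K_def)
    then show "emeasure lebesgue {g (fst i)..g (snd i)} \<le> ennreal p * emeasure lebesgue {fst i..snd i}"
      using mono p by (auto simp: strict_mono_less_eq ennreal_mult'[symmetric] intro!: ennreal_leI)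
  qed
  also have "\<dots> = ennreal p * emeasure lebesgue ?W"
    using C(1) disj by (subst emeasure_UN_countable) (auto simp: nn_integral_cmult)
  also have "\<dots> \<le> ennreal p * emeasure lebesgue (E \<union> (T - E))"
  proof (intro mult_left_mono emeasure_mono)
    have "{fst i..snd i} \<subseteq> T" if "i \<in> C" for i
      using subsetD[OF C(2) that] by (simp add: K_def case_prod_beta)
    then show "?W \<subseteq> E \<union> (T - E)" by blast
    show "E \<union> (T - E) \<in> sets lebesgue"
      using E T(3) by (intro sets.Un) auto
  qed simp
  also have "\<dots> \<le> ennreal p * (emeasure lebesgue E + emeasure lebesgue (T - E))"
    using T E by (intro mult_left_mono emeasure_subadditive) auto
  also have "\<dots> \<le> ennreal p * (emeasure lebesgue E + ennreal (e / p))"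
    using T(4) by (intro mult_left_mono add_left_mono) auto
  also have "\<dots> = ennreal p * emeasure lebesgue E + ennreal e"
    using p e by (simp add: distrib_left ennreal_mult'[symmetric])
  finally show "emeasure lebesgue (g ` E) \<le> ennreal p * emeasure lebesgue E + ennreal e" .
qed

text \<open>For fixed d the set is a union of open intervals, hence open for an arbitrary
  \<open>P\<close>; letting d run through 1/(n+1) gives a countable intersection of open sets. This
  is why x is kept strictly inside the intervals.\<close>

lemma borel_small_intervals:
  fixes P :: "real \<Rightarrow> real \<Rightarrow> bool"
  shows "{x. \<forall>d>0. \<exists>a b. a < x \<and> x < b \<and> b - a < d \<and> P a b} \<in> sets borel"
proof -
  let ?U = "\<lambda>d. \<Union>i\<in>{(a, b). b - a < d \<and> P a b}. {fst i<..<snd i}"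
  have "{x. \<forall>d>0. \<exists>a b. a < x \<and> x < b \<and> b - a < d \<and> P a b} = (\<Inter>n. ?U (1 / real (Suc n)))"
  proof (rule set_eqI, rule iffI)
    fix x assume x: "x \<in> {x. \<forall>d>0. \<exists>a b. a < x \<and> x < b \<and> b - a < d \<and> P a b}"
    show "x \<in> (\<Inter>n. ?U (1 / real (Suc n)))"
    proof (rule INT_I)
      fix n
      have "0 < 1 / real (Suc n)" by simp
      with x obtain a b where "a < x" "x < b" "b - a < 1 / real (Suc n)" "P a b"
        by blast
      then show "x \<in> ?U (1 / real (Suc n))"
        by (intro UN_I[of "(a, b)"]) simp_all
    qed
  next
    fix x assume x: "x \<in> (\<Inter>n. ?U (1 / real (Suc n)))"
    show "x \<in> {x. \<forall>d>0. \<exists>a b. a < x \<and> x < b \<and> b - a < d \<and> P a b}"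
    proof safe
      fix d :: real assume "0 < d"
      then obtain n where "1 / real (Suc n) < d"
        by (metis nat_approx_posE)
      moreover have "x \<in> ?U (1 / real (Suc n))" using x by blast
      then obtain i where "i \<in> {(a, b). b - a < 1 / real (Suc n) \<and> P a b}" "x \<in> {fst i<..<snd i}"
        by (rule UN_E)
      ultimately show "\<exists>a b. a < x \<and> x < b \<and> b - a < d \<and> P a b"
        by (intro exI[of _ "fst i"] exI[of _ "snd i"]) (simp add: case_prod_beta)
    qed
  qed
  moreover have "?U d \<in> sets borel" for d
    by (intro borel_open open_UN ballI) auto
  ultimately show ?thesis
    by (simp add: sets.countable_INT)
qed

lemma negligible_two_slopes:
  fixes g :: "real \<Rightarrow> real"
  assumes low: "\<And>x y. x \<le> y \<Longrightarrow> y - x \<le> g y - g x"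
    and up: "\<And>x y. x \<le> y \<Longrightarrow> g y - g x \<le> M * (y - x)"
    and pq: "0 < p" "p < q"
  shows "negligible {x. (\<forall>d>0. \<exists>a b. a < x \<and> x < b \<and> b - a < d \<and> g b - g a \<le> p * (b - a)) \<and>
    (\<forall>d>0. \<exists>a b. a < x \<and> x < b \<and> b - a < d \<and> q * (b - a) \<le> g b - g a)}" (is "negligible ?E")
proof -
  have M: "M \<ge> 1" using low[of 0 1] up[of 0 1] by simp
  have mono: "strict_mono g"
  proof (rule strict_monoI)
    fix x y :: real assume "x < y"
    then show "g x < g y" using low[of x y] by simp
  qed
  have lip: "M-lipschitz_on UNIV g"
  proof (rule lipschitz_onI)
    fix x y :: real
    show "dist (g x) (g y) \<le> M * dist x y"
      using low[of x y] up[of x y] low[of y x] up[of y x] by (cases "x \<le> y") (auto simp: dist_real_def)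
  qed (use M in simp)
  then have cont: "continuous_on UNIV g"
    by (rule lipschitz_on_continuous_on)
  have inj: "inj g"
    using mono by (rule strict_mono_imp_inj_on)
  have surj: "\<exists>x. g x = y" for y
  proof -
    \<comment> \<open>Slopes at least 1 give g b \<ge> g 0 + b \<ge> y and, symmetrically, g(-b)
      \<le> y, so the intermediate value theorem applies.\<close>
    define b where "b = \<bar>y - g 0\<bar>"
    have "g (- b) \<le> y" "y \<le> g b"
      using low[of "-b" 0] low[of 0 b] by (auto simp: b_def)
    then show ?thesis
      using IVT'[of g "-b" y b] continuous_on_subset[OF cont] by (auto simp: b_def)
  qed
  define h where "h = inv g"
  have "surj g"
    unfolding surj_def using surj by metis
  then have gh: "g (h y) = y" for y
    unfolding h_def by (rule surj_f_inv_f)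
  have hg: "h (g x) = x" for x
    unfolding h_def using inj by (rule inv_f_f)
  have hmono: "strict_mono h"
  proof (rule strict_monoI)
    fix x y :: real assume "x < y"
    then have "g (h x) < g (h y)" by (simp only: gh)
    then show "h x < h y" using mono by (simp only: strict_mono_less)
  qed
  have hlip: "1-lipschitz_on UNIV h"
  proof (rule lipschitz_onI)
    fix x y :: real
    show "dist (h x) (h y) \<le> 1 * dist x y"
      using low[of "h x" "h y"] low[of "h y" "h x"] by (cases "h x \<le> h y") (auto simp: dist_real_def gh)
  qed simp
  \<comment> \<open>Bounded parts have finite measure, without which |E| \<le> (p/q) |E| would not
    force |E| = 0.\<close>
  define E where "E k = ?E \<inter> {- real k..real k}" for k
  have "?E \<in> sets borel"
    unfolding Collect_conj_eq
    by (intro sets.Int borel_small_intervals[of "\<lambda>a b. g b - g a \<le> p * (b - a)"]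
        borel_small_intervals[of "\<lambda>a b. q * (b - a) \<le> g b - g a"])
  then have E: "E k \<in> sets lebesgue" for k
    by (simp add: E_def)
  have "negligible (E k)" for k
  proof -
    have fin: "emeasure lebesgue (E k) < \<infinity>"
    proof -
      have "emeasure lebesgue (E k) \<le> emeasure lebesgue {- real k..real k}"
        by (intro emeasure_mono) (auto simp: E_def)
      also have "\<dots> < \<infinity>" by simp
      finally show ?thesis .
    qed
    have gE: "g ` E k \<in> sets lebesgue"
    proof (rule sets_lebesgue_continuous_image[OF E cont])
      fix N :: "real set" assume N: "negligible N"
      show "negligible (g ` N)"
      proof (rule negligible_locally_Lipschitz_image[OF _ N])
        fix x
        have "norm (g y - g x) \<le> M * norm (y - x)" for y
          using lipschitz_on_normD[OF lip] by simp
        then show "\<exists>T B. open T \<and> x \<in> T \<and> (\<forall>y\<in>N \<inter> T. norm (g y - g x) \<le> B * norm (y - x))"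
          by (intro exI[of _ UNIV] exI[of _ M]) auto
      qed simp
    qed simp
    have "emeasure lebesgue (g ` E k) \<le> ennreal p * emeasure lebesgue (E k)"
    proof (rule emeasure_image_le_slope[OF mono lip E pq(1)])
      fix x d :: real assume "x \<in> E k" "0 < d"
      then have "\<exists>a b. a < x \<and> x < b \<and> b - a < d \<and> g b - g a \<le> p * (b - a)"
        by (simp add: E_def)
      then show "\<exists>a b. a < b \<and> a \<le> x \<and> x \<le> b \<and> b - a < d \<and> g b - g a \<le> p * (b - a)"
        by (meson less_imp_le less_trans)
    qed
    moreover have "emeasure lebesgue (h ` g ` E k) \<le> ennreal (1 / q) * emeasure lebesgue (g ` E k)"
    proof (rule emeasure_image_le_slope[OF hmono hlip gE])
      show "0 < 1 / q" using pq by simp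
      fix y d :: real assume "y \<in> g ` E k" "0 < d"
      then obtain x where x: "x \<in> E k" "y = g x" by blast
      have "0 < d / M" using \<open>0 < d\<close> M by simp
      then obtain a b where ab: "a < x" "x < b" "b - a < d / M" "q * (b - a) \<le> g b - g a"
        using x unfolding E_def by blast
      have "g a < g b" "g a \<le> y" "y \<le> g b"
        using mono ab x by (auto simp: strict_mono_less strict_mono_less_eq)
      moreover have "g b - g a < d"
      proof -
        have "g b - g a \<le> M * (b - a)" using up[of a b] ab by simp
        also have "\<dots> < d" using ab M by (simp add: field_simps)
        finally show ?thesis .
      qed
      moreover have "h (g b) - h (g a) \<le> 1 / q * (g b - g a)"
        using ab pq by (simp add: hg field_simps)
      ultimately show "\<exists>a b. a < b \<and> a \<le> y \<and> y \<le> b \<and> b - a < d \<and> h b - h a \<le> 1 / q * (b - a)"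
        by blast
    qed
    ultimately have "emeasure lebesgue (E k) \<le> ennreal (1 / q) * (ennreal p * emeasure lebesgue (E k))"
      by (simp add: image_image hg) (meson mult_left_mono order_trans zero_le)
    then have le: "emeasure lebesgue (E k) \<le> ennreal (p / q) * emeasure lebesgue (E k)"
      using pq by (simp add: mult.assoc[symmetric] ennreal_mult'[symmetric])
    have "emeasure lebesgue (E k) = 0"
    proof (rule ccontr)
      assume "emeasure lebesgue (E k) \<noteq> 0"
      then have "ennreal (p / q) * emeasure lebesgue (E k) < 1 * emeasure lebesgue (E k)"
        using fin pq by (intro ennreal_mult_strict_right_mono) (auto simp: zero_less_iff_neq_zero)
      with le show False by simp
    qed
    then show ?thesis
      using E by (simp add: negligible_iff_null_sets null_sets_def)
  qed
  then have "negligible (\<Union>k. E k)"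
    by (intro negligible_countable_Union) auto
  moreover have "?E \<subseteq> (\<Union>k. E k)"
  proof
    fix x assume x: "x \<in> ?E"
    obtain k where "\<bar>x\<bar> \<le> real k" using real_arch_simple by blast
    then have "x \<in> E k" using x by (auto simp: E_def)
    then show "x \<in> (\<Union>k. E k)" by blast
  qed
  ultimately show ?thesis
    by (rule negligible_subset)
qed

text \<open>A difference quotient at x belongs to an interval ending at x, while
  \<open>borel_small_intervals\<close> has x in the interior. The strict inequality leaves a margin
  \<open>\<eta>\<close>: moving the endpoint across x by s raises the increment by at most
  \<open>M * s\<close>, which the margin absorbs, and \<open>d / 4\<close> keeps the total length
  below d.\<close>

lemma steep_interval_left:
  fixes g :: "real \<Rightarrow> real"
  assumes up: "\<And>x y. x \<le> y \<Longrightarrow> g y - g x \<le> M * (y - x)" and p: "0 < p" and M: "0 < M"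
    and t: "t \<noteq> 0" "\<bar>t\<bar> < d / 2" "(g (x + t) - g x) / t < p"
  shows "\<exists>a b. a < x \<and> x < b \<and> b - a < d \<and> g b - g a \<le> p * (b - a)"
proof (cases "0 < t")
  case True
  define \<eta> where "\<eta> = p * t - (g (x + t) - g x)"
  have \<eta>: "0 < \<eta>" using t True by (simp add: \<eta>_def field_simps)
  define s where "s = min (\<eta> / M) (d / 4)"
  have s: "0 < s" "M * s \<le> \<eta>" "s < d / 2"
    using \<eta> M t by (auto simp: s_def min_def field_simps)
  have "g (x + t) - g (x - s) \<le> p * t"
    using up[of "x - s" x] s by (simp add: \<eta>_def)
  also have "\<dots> \<le> p * ((x + t) - (x - s))"
    using p s by simp
  finally show ?thesis
    using s t True by (intro exI[of _ "x - s"] exI[of _ "x + t"]) auto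
next
  case False
  define \<eta> where "\<eta> = p * (- t) - (g x - g (x + t))"
  have \<eta>: "0 < \<eta>" using t False by (simp add: \<eta>_def field_simps)
  define s where "s = min (\<eta> / M) (d / 4)"
  have s: "0 < s" "M * s \<le> \<eta>" "s < d / 2"
    using \<eta> M t by (auto simp: s_def min_def field_simps)
  have "g (x + s) - g (x + t) \<le> p * (- t)"
    using up[of x "x + s"] s by (simp add: \<eta>_def)
  also have "\<dots> \<le> p * ((x + s) - (x + t))"
    using mult_pos_pos[OF p s(1)] by (simp add: algebra_simps)
  finally show ?thesis
    using s t False by (intro exI[of _ "x + t"] exI[of _ "x + s"]) auto
qed

text \<open>Here monotonicity does the work: the longer interval has at least the same increment of
  g, and the extra length s costs at most \<open>q * s\<close>, which the margin
  \<open>\<eta>\<close> covers.\<close>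

lemma steep_interval_right:
  fixes g :: "real \<Rightarrow> real"
  assumes mono: "\<And>x y. x \<le> y \<Longrightarrow> g x \<le> g y" and q: "0 < q"
    and t: "t \<noteq> 0" "\<bar>t\<bar> < d / 2" "q < (g (x + t) - g x) / t"
  shows "\<exists>a b. a < x \<and> x < b \<and> b - a < d \<and> q * (b - a) \<le> g b - g a"
proof (cases "0 < t")
  case True
  define \<eta> where "\<eta> = (g (x + t) - g x) - q * t"
  have \<eta>: "0 < \<eta>" using t True by (simp add: \<eta>_def field_simps)
  define s where "s = min (\<eta> / q) (d / 4)"
  have s: "0 < s" "q * s \<le> \<eta>" "s < d / 2"
    using \<eta> q t by (auto simp: s_def min_def field_simps)
  have "q * ((x + t) - (x - s)) \<le> g (x + t) - g (x - s)"
    using mono[of "x - s" x] s by (simp add: \<eta>_def algebra_simps)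
  then show ?thesis
    using s t True by (intro exI[of _ "x - s"] exI[of _ "x + t"]) auto
next
  case False
  define \<eta> where "\<eta> = (g x - g (x + t)) - q * (- t)"
  have \<eta>: "0 < \<eta>" using t False by (simp add: \<eta>_def field_simps)
  define s where "s = min (\<eta> / q) (d / 4)"
  have s: "0 < s" "q * s \<le> \<eta>" "s < d / 2"
    using \<eta> q t by (auto simp: s_def min_def field_simps)
  have "q * ((x + s) - (x + t)) \<le> g (x + s) - g (x + t)"
    using mono[of x "x + s"] s by (simp add: \<eta>_def algebra_simps)
  then show ?thesis
    using s t False by (intro exI[of _ "x + t"] exI[of _ "x + s"]) auto
qed

lemma negligible_not_differentiable_real:
  fixes f :: "real \<Rightarrow> real"
  assumes lip: "L-lipschitz_on UNIV f"
  shows "negligible {x. \<not> f differentiable (at x)}"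
proof -
  have L: "0 \<le> L" using lip by (rule lipschitz_on_nonneg)
  define g where "g x = f x + (L + 1) * x" for x
  define M where "M = 2 * L + 1"
  have M: "1 \<le> M" using L by (simp add: M_def)
  have bound: "y - x \<le> g y - g x \<and> g y - g x \<le> M * (y - x)" if "x \<le> y" for x y
  proof -
    have "\<bar>f y - f x\<bar> \<le> L * (y - x)"
      using lipschitz_onD[OF lip, of y x] that by (simp add: dist_real_def)
    then have "f y - f x \<le> L * (y - x)" "- (L * (y - x)) \<le> f y - f x"
      by linarith+
    then show ?thesis
      unfolding g_def M_def by (simp add: algebra_simps)
  qed
  have low: "\<And>x y. x \<le> y \<Longrightarrow> y - x \<le> g y - g x" and up: "\<And>x y. x \<le> y \<Longrightarrow> g y - g x \<le> M * (y - x)"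
    using bound by blast+
  have mono: "g x \<le> g y" if "x \<le> y" for x y
    using low[OF that] that by linarith
  let ?E = "\<lambda>p q. {x. (\<forall>d>0. \<exists>a b. a < x \<and> x < b \<and> b - a < d \<and> g b - g a \<le> p * (b - a)) \<and>
    (\<forall>d>0. \<exists>a b. a < x \<and> x < b \<and> b - a < d \<and> q * (b - a) \<le> g b - g a)}"
  let ?I = "{(p, q). p \<in> \<rat> \<and> q \<in> \<rat> \<and> 0 < p \<and> p < q}"
  have "?I \<subseteq> \<rat> \<times> \<rat>" by auto
  then have "countable ?I"
    by (rule countable_subset) (intro countable_SIGMA countable_rat)
  then have count: "countable ((\<lambda>i. ?E (fst i) (snd i)) ` ?I)"
    by (rule countable_image)
  have neg: "negligible (\<Union>i\<in>?I. ?E (fst i) (snd i))"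
  proof (rule negligible_countable_Union[OF count])
    fix N assume "N \<in> (\<lambda>i. ?E (fst i) (snd i)) ` ?I"
    then obtain i where i: "i \<in> ?I" "N = ?E (fst i) (snd i)" by blast
    show "negligible N"
      unfolding i(2) by (rule negligible_two_slopes[OF low up]) (use i(1) in auto)
  qed
  have "f differentiable (at x)" if x: "x \<notin> (\<Union>i\<in>?I. ?E (fst i) (snd i))" for x
  proof -
    define D where "D t = (g (x + t) - g x) / t" for t
    have D: "1 \<le> D t \<and> D t \<le> M" if "t \<noteq> 0" for t
      using that low[of x "x + t"] up[of x "x + t"] low[of "x + t" x] up[of "x + t" x]
      by (cases "0 < t") (auto simp: D_def field_simps)
    \<comment> \<open>\<open>C\<close> collects the eventual lower bounds of the quotients, so
      \<open>l = Sup C\<close> is their lower limit; it exists because the quotients stay between 1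
      and M, and l \<ge> 1 makes the slopes chosen above it positive.\<close>
    define C where "C = {c. \<forall>\<^sub>F t in at 0. c \<le> D t}"
    have C1: "1 \<in> C"
      unfolding C_def using D by (auto simp: eventually_at_filter)
    have CM: "c \<le> M" if "c \<in> C" for c
    proof -
      have "\<forall>\<^sub>F t in at 0. c \<le> D t \<and> D t \<le> M"
        using that D by (auto simp: C_def eventually_at_filter elim!: eventually_mono)
      then have "\<forall>\<^sub>F t :: real in at 0. c \<le> M"
        by (rule eventually_mono) auto
      then show ?thesis by simp
    qed
    have bdd: "bdd_above C" using CM by (rule bdd_aboveI)
    define l where "l = Sup C"
    have l: "1 \<le> l" unfolding l_def by (rule cSup_upper[OF C1 bdd])
    have "(D \<longlongrightarrow> l) (at 0)"
    proof (rule order_tendstoI)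
      fix a assume "a < l"
      then obtain c where "c \<in> C" "a < c"
        unfolding l_def using C1 by (metis less_cSupE empty_iff)
      then show "\<forall>\<^sub>F t in at 0. a < D t"
        unfolding C_def by (auto elim: eventually_mono)
    next
      \<comment> \<open>If quotients \<ge> a occurred at arbitrarily small steps, rationals l < p <
        q < a would place x in an exceptional set: p is not an eventual lower bound, so slopes below
        p occur at every scale, and so do slopes above q.\<close>
      fix a assume "l < a"
      then obtain q where q: "q \<in> \<rat>" "l < q" "q < a"
        using Rats_dense_in_real by blast
      then obtain p where p: "p \<in> \<rat>" "l < p" "p < q"
        using Rats_dense_in_real by blast
      then have pq: "(p, q) \<in> ?I" using q l by auto
      have low_slope: "\<exists>a b. a < x \<and> x < b \<and> b - a < d \<and> g b - g a \<le> p * (b - a)" if d: "0 < d" for d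
      proof -
        have "p \<notin> C" using p cSup_upper[OF _ bdd, of p] by (auto simp: l_def)
        have "\<not> (\<forall>t. t \<noteq> 0 \<and> dist t 0 < d / 2 \<longrightarrow> p \<le> D t)"
        proof
          assume "\<forall>t. t \<noteq> 0 \<and> dist t 0 < d / 2 \<longrightarrow> p \<le> D t"
          then have "\<forall>\<^sub>F t in at 0. p \<le> D t"
            unfolding eventually_at using d by (intro exI[of _ "d / 2"]) simp
          then show False using \<open>p \<notin> C\<close> by (simp add: C_def)
        qed
        then obtain t where "t \<noteq> 0" "\<bar>t\<bar> < d / 2" "D t < p"
          by (auto simp: not_le)
        then show ?thesis
          unfolding D_def using p l M by (intro steep_interval_left[OF up]) auto
      qed
      show "\<forall>\<^sub>F t in at 0. D t < a"
      proof (rule ccontr)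
        assume *: "\<not> (\<forall>\<^sub>F t in at 0. D t < a)"
        have "\<exists>a b. a < x \<and> x < b \<and> b - a < d \<and> q * (b - a) \<le> g b - g a" if d: "0 < d" for d
        proof -
          have "\<not> (\<forall>t. t \<noteq> 0 \<and> dist t 0 < d / 2 \<longrightarrow> D t < a)"
          proof
            assume "\<forall>t. t \<noteq> 0 \<and> dist t 0 < d / 2 \<longrightarrow> D t < a"
            then have "\<forall>\<^sub>F t in at 0. D t < a"
              unfolding eventually_at using d by (intro exI[of _ "d / 2"]) simp
            with * show False ..
          qed
          then obtain t where "t \<noteq> 0" "\<bar>t\<bar> < d / 2" "a \<le> D t"
            by (auto simp: not_less)
          then show ?thesis
            unfolding D_def using q l by (intro steep_interval_right[OF mono]) auto
        qed
        with low_slope have "x \<in> ?E (fst (p, q)) (snd (p, q))" by simp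
        with x pq show False by blast
      qed
    qed
    then have "(g has_field_derivative l) (at x)"
      by (simp add: DERIV_def D_def[abs_def])
    then have "((\<lambda>x. g x - (L + 1) * x) has_field_derivative l - (L + 1)) (at x)"
      by (auto intro!: derivative_eq_intros)
    then have "(f has_field_derivative l - (L + 1)) (at x)"
      by (simp add: g_def)
    then show ?thesis
      using real_differentiable_def by blast
  qed
  then show ?thesis
    by (intro negligible_subset[OF neg]) blast
qed

subsection \<open>Rademacher's theorem\<close>

lemma negligible_UN_countable:
  assumes "countable I" "\<And>i. i \<in> I \<Longrightarrow> negligible (A i)"
  shows "negligible (\<Union>i\<in>I. A i)"
  by (rule negligible_countable_Union) (use assms in auto)

text \<open>Fubini in an arbitrary direction without rotating coordinates: integrate the indicator
  of X at x + t v over all x and all t. Integrating over x first gives |X| for every t by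
  translation invariance, hence infinity times |X|; integrating over t first gives 0.\<close>

lemma negligible_if_negligible_on_lines:
  fixes X :: "'a::euclidean_space set"
  assumes X: "X \<in> sets borel" and lines: "\<And>x. negligible {t::real. x + t *\<^sub>R v \<in> X}"
  shows "negligible X"
proof -
  let ?I = "indicator X :: 'a \<Rightarrow> ennreal"
  have meas: "(\<lambda>(x, t). ?I (x + t *\<^sub>R v)) \<in> borel_measurable (lborel \<Otimes>\<^sub>M (lborel :: real measure))"
  proof -
    have "(\<lambda>z. fst z + snd z *\<^sub>R v) \<in> borel_measurable (lborel \<Otimes>\<^sub>M (lborel :: real measure))"
      by measurable
    from measurable_compose[OF this borel_measurable_indicator[OF X]] show ?thesis
      by (simp add: case_prod_beta')
  qed
  have inner: "(\<integral>\<^sup>+t. ?I (x + t *\<^sub>R v) \<partial>lborel) = 0" for x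
  proof -
    have "(\<lambda>t::real. x + t *\<^sub>R v) \<in> borel_measurable borel"
      by measurable
    then have b: "{t::real. x + t *\<^sub>R v \<in> X} \<in> sets borel"
      using measurable_sets[of "\<lambda>t. x + t *\<^sub>R v" borel borel X] X by (simp add: vimage_def)
    have "emeasure lborel {t::real. x + t *\<^sub>R v \<in> X} = 0"
      using lines[of x] b by (simp add: negligible_iff_null_sets null_sets_def)
    moreover have "(\<integral>\<^sup>+t. ?I (x + t *\<^sub>R v) \<partial>lborel) = (\<integral>\<^sup>+t. indicator {t. x + t *\<^sub>R v \<in> X} t \<partial>lborel)"
      by (intro nn_integral_cong) (simp add: indicator_def)
    ultimately show ?thesis using b by simp
  qed
  have shift: "(\<integral>\<^sup>+x. ?I (x + c) \<partial>lborel) = emeasure lborel X" for c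
  proof -
    have "emeasure lborel X = (\<integral>\<^sup>+x. ?I x \<partial>distr lborel borel ((+) c))"
      using X by (simp add: lborel_distr_plus)
    also have "\<dots> = (\<integral>\<^sup>+x. ?I (c + x) \<partial>lborel)"
      using X by (intro nn_integral_distr) auto
    finally show ?thesis by (simp add: add.commute)
  qed
  have "(\<integral>\<^sup>+t. emeasure lborel X \<partial>(lborel :: real measure)) = (\<integral>\<^sup>+x. \<integral>\<^sup>+t. ?I (x + t *\<^sub>R v) \<partial>lborel \<partial>lborel)"
    using lborel_pair.Fubini'[OF meas] by (simp add: shift)
  also have "\<dots> = 0" by (simp add: inner)
  finally have "emeasure lborel X = 0" by simp
  then show ?thesis
    using X by (simp add: negligible_iff_null_sets null_sets_def)
qed

text \<open>The approximating vectors for different tolerances are compatible: near 0 both describe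
  the same increment, so they differ by at most the sum of their tolerances. They form a Cauchy
  sequence, and its limit is the gradient.\<close>

lemma differentiable_if_almost_linear:
  fixes f :: "'a::euclidean_space \<Rightarrow> real"
  assumes "\<And>e. 0 < e \<Longrightarrow> \<exists>a d. 0 < d \<and> (\<forall>h. norm h < d \<longrightarrow> \<bar>f (x + h) - f x - a \<bullet> h\<bar> \<le> e * norm h)"
  shows "f differentiable (at x)"
proof -
  define \<epsilon> where "\<epsilon> k = 1 / real (Suc k)" for k
  have \<epsilon>: "0 < \<epsilon> k" for k by (simp add: \<epsilon>_def)
  have "\<forall>k. \<exists>a d. 0 < d \<and> (\<forall>h. norm h < d \<longrightarrow> \<bar>f (x + h) - f x - a \<bullet> h\<bar> \<le> \<epsilon> k * norm h)"
    using assms[OF \<epsilon>] by blast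
  then obtain a where "\<forall>k. \<exists>d. 0 < d \<and> (\<forall>h. norm h < d \<longrightarrow> \<bar>f (x + h) - f x - a k \<bullet> h\<bar> \<le> \<epsilon> k * norm h)"
    by (rule choice[THEN exE])
  then obtain d where "\<forall>k. 0 < d k \<and> (\<forall>h. norm h < d k \<longrightarrow> \<bar>f (x + h) - f x - a k \<bullet> h\<bar> \<le> \<epsilon> k * norm h)"
    by (rule choice[THEN exE])
  then have d: "0 < d k" and lin: "norm h < d k \<Longrightarrow> \<bar>f (x + h) - f x - a k \<bullet> h\<bar> \<le> \<epsilon> k * norm h" for k h
    by blast+
  have close: "norm (a j - a k) \<le> \<epsilon> j + \<epsilon> k" for j k
  proof (cases "a j = a k")
    case False
    define w where "w = a j - a k"
    have w: "0 < norm w" using False by (simp add: w_def)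
    \<comment> \<open>The test increment points along the difference of the two vectors and is short
      enough for both estimates.\<close>
    define s where "s = min (d j) (d k) / (2 * norm w)"
    have s: "0 < s" using d w by (simp add: s_def)
    have "norm (s *\<^sub>R w) = min (d j) (d k) / 2"
      using s w d[of j] d[of k] by (simp add: s_def)
    then have "norm (s *\<^sub>R w) < d j" "norm (s *\<^sub>R w) < d k"
      using d[of j] d[of k] by auto
    then have "\<bar>a j \<bullet> (s *\<^sub>R w) - a k \<bullet> (s *\<^sub>R w)\<bar> \<le> \<epsilon> j * norm (s *\<^sub>R w) + \<epsilon> k * norm (s *\<^sub>R w)"
      using lin[of "s *\<^sub>R w" j] lin[of "s *\<^sub>R w" k] by linarith
    also have "a j \<bullet> (s *\<^sub>R w) - a k \<bullet> (s *\<^sub>R w) = w \<bullet> (s *\<^sub>R w)"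
      by (simp only: w_def inner_diff_left)
    also have "\<dots> = s * (norm w * norm w)"
      by (simp add: dot_square_norm power2_eq_square)
    also have "\<epsilon> j * norm (s *\<^sub>R w) + \<epsilon> k * norm (s *\<^sub>R w) = (s * norm w) * (\<epsilon> j + \<epsilon> k)"
      using s by (simp add: algebra_simps)
    finally have "(s * norm w) * norm w \<le> (s * norm w) * (\<epsilon> j + \<epsilon> k)"
      using s by (simp add: mult.assoc)
    then show ?thesis
      using s w by (simp add: w_def)
  qed (use \<epsilon>[of j] \<epsilon>[of k] in simp)
  have small: "\<exists>n. \<forall>k\<ge>n. \<epsilon> k < e" if e: "0 < e" for e
  proof -
    obtain n where n: "\<epsilon> n < e"
      using e unfolding \<epsilon>_def by (rule nat_approx_posE)
    have "\<epsilon> k \<le> \<epsilon> n" if "n \<le> k" for k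
      using that by (simp add: \<epsilon>_def field_simps)
    with n show ?thesis by (meson le_less_trans)
  qed
  have "Cauchy a"
  proof (rule CauchyI)
    fix e :: real assume "0 < e"
    then obtain n where n: "\<forall>k\<ge>n. \<epsilon> k < e / 2" using small[of "e / 2"] by auto
    have "norm (a j - a k) < e" if "n \<le> j" "n \<le> k" for j k
    proof -
      have "\<epsilon> j < e / 2" "\<epsilon> k < e / 2" using n that by auto
      then show ?thesis using close[of j k] by linarith
    qed
    then show "\<exists>M. \<forall>m\<ge>M. \<forall>n\<ge>M. norm (a m - a n) < e" by blast
  qed
  then obtain b where b: "a \<longlonglongrightarrow> b"
    using convergent_eq_Cauchy by blast
  have "(f has_derivative (\<lambda>h. b \<bullet> h)) (at x)"
    unfolding has_derivative_at_alt
  proof (intro conjI allI impI)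
    show "bounded_linear ((\<bullet>) b)" by (rule bounded_linear_inner_right)
    fix e :: real assume "0 < e"
    then have "0 < e / 2" by simp
    then obtain n1 where n1: "\<forall>k\<ge>n1. \<epsilon> k < e / 2" using small by blast
    obtain n2 where n2: "\<forall>k\<ge>n2. norm (a k - b) < e / 2"
      using LIMSEQ_D[OF b \<open>0 < e / 2\<close>] by blast
    define k where "k = max n1 n2"
    have k: "\<epsilon> k < e / 2" "norm (a k - b) < e / 2"
      using n1 n2 by (auto simp: k_def)
    have "norm (f y - f x - b \<bullet> (y - x)) \<le> e * norm (y - x)" if "norm (y - x) < d k" for y
    proof -
      have "\<bar>f y - f x - a k \<bullet> (y - x)\<bar> \<le> \<epsilon> k * norm (y - x)"
        using lin[OF that] by simp
      moreover have "\<bar>a k \<bullet> (y - x) - b \<bullet> (y - x)\<bar> \<le> norm (a k - b) * norm (y - x)"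
        unfolding inner_diff_left[symmetric] by (rule Cauchy_Schwarz_ineq2)
      moreover have "\<epsilon> k * norm (y - x) \<le> e / 2 * norm (y - x)"
        "norm (a k - b) * norm (y - x) \<le> e / 2 * norm (y - x)"
        using k by (intro mult_right_mono; simp)+
      ultimately show ?thesis
        unfolding real_norm_def by (simp add: field_simps)
    qed
    then show "\<exists>d>0. \<forall>y. norm (y - x) < d \<longrightarrow> norm (f y - f x - b \<bullet> (y - x)) \<le> e * norm (y - x)"
      using d by blast
  qed
  then show ?thesis by (auto simp: differentiable_def)
qed

section \<open>Slope sets and almost linearity at their density points\<close>

definition slope_set :: "('a::euclidean_space \<Rightarrow> real) \<Rightarrow> 'a \<Rightarrow> real \<Rightarrow> real \<Rightarrow> nat \<Rightarrow> 'a set" where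
  "slope_set f v e a N = {x. \<forall>t. \<bar>t\<bar> < 1 / real (Suc N) \<longrightarrow> \<bar>f (x + t *\<^sub>R v) - f x - a * t\<bar> \<le> e * \<bar>t\<bar>}"

text \<open>For fixed \<open>t\<close> the condition is a weak inequality between continuous
  functions of x. Closedness makes the countable unions Borel, as integration along lines
  requires.\<close>

lemma closed_slope_set:
  assumes "continuous_on UNIV f"
  shows "closed (slope_set f v e a N)"
proof -
  have "continuous_on UNIV (\<lambda>x. f (x + t *\<^sub>R v))" for t
    by (rule continuous_on_compose2[OF assms]) (auto intro!: continuous_intros)
  then show ?thesis
    unfolding slope_set_def
    by (intro closed_Collect_all closed_Collect_imp closed_Collect_le continuous_intros assms) auto
qed

text \<open>Origin of the constant, with n = \<open>DIM('a)\<close>: an intermediate point p of the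
  coordinate walk is within n |h| of x, so some q of the slope set is within e n |h| of p. Moving
  the two ends of a step from p to q costs 2 L e n |h|, the slope estimate at q costs e |h|, and
  there are n steps.\<close>

lemma slope_set_density_almost_linear:
  fixes f :: "'a::euclidean_space \<Rightarrow> real" and L :: real
  assumes lip: "L-lipschitz_on UNIV f" and e: "0 < e"
    and x: "\<And>v. v \<in> Basis \<Longrightarrow> x \<in> slope_set f v e (a v) (N v)"
    and dens: "\<And>v. v \<in> Basis \<Longrightarrow> has_lebesgue_density (slope_set f v e (a v) (N v)) x 1"
  shows "\<exists>d>0. \<forall>h. norm h < d \<longrightarrow> \<bar>f (x + h) - f x - (\<Sum>v\<in>Basis. a v *\<^sub>R v) \<bullet> h\<bar>
    \<le> real DIM('a) * ((2 * L * real DIM('a) + 1) * e) * norm h"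
proof -
  let ?n = "real DIM('a)"
  have L: "0 \<le> L" using lip by (rule lipschitz_on_nonneg)
  have Lip: "\<bar>f y - f z\<bar> \<le> L * norm (y - z)" for y z
    using lipschitz_on_normD[OF lip, of y z] by simp
  have "\<exists>d>0. \<forall>y. norm (y - x) < d \<longrightarrow> (\<exists>q\<in>slope_set f v e (a v) (N v). norm (q - y) \<le> e * norm (y - x))"
    if v: "v \<in> Basis" for v
  proof -
    obtain d where d: "0 < d" "\<And>y. norm (y - x) < d \<Longrightarrow> y \<noteq> x \<Longrightarrow>
        \<exists>q\<in>slope_set f v e (a v) (N v). norm (q - y) \<le> e * norm (y - x)"
      using density_1_near[OF dens[OF v] e] by blast
    have "\<exists>q\<in>slope_set f v e (a v) (N v). norm (q - y) \<le> e * norm (y - x)" if "norm (y - x) < d" for y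
      using d(2)[OF that] x[OF v] by (cases "y = x") auto
    with d show ?thesis by blast
  qed
  then obtain d where d: "\<And>v. v \<in> Basis \<Longrightarrow> 0 < d v"
    and near: "\<And>v y. v \<in> Basis \<Longrightarrow> norm (y - x) < d v \<Longrightarrow>
      \<exists>q\<in>slope_set f v e (a v) (N v). norm (q - y) \<le> e * norm (y - x)"
    by metis
  \<comment> \<open>Division by the dimension keeps all intermediate points within
    \<open>d v\<close> of x; the bound by \<open>1 / real (Suc (N v))\<close> makes every coordinate
    step short enough for its slope set.\<close>
  define \<delta> where "\<delta> = Min ((\<lambda>v. min (d v / ?n) (1 / real (Suc (N v)))) ` Basis)"
  have \<delta>: "0 < \<delta>"
    unfolding \<delta>_def using d by (subst Min_gr_iff) auto
  have \<delta>': "\<delta> \<le> d v / ?n" "\<delta> \<le> 1 / real (Suc (N v))" if "v \<in> Basis" for v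
  proof -
    have "\<delta> \<le> min (d v / ?n) (1 / real (Suc (N v)))"
      unfolding \<delta>_def using that by (intro Min_le) auto
    then show "\<delta> \<le> d v / ?n" "\<delta> \<le> 1 / real (Suc (N v))" by simp_all
  qed
  have "\<bar>f (x + h) - f x - (\<Sum>v\<in>Basis. a v *\<^sub>R v) \<bullet> h\<bar> \<le> ?n * ((2 * L * ?n + 1) * e) * norm h"
    if h: "norm h < \<delta>" for h
  proof -
    have coord: "\<bar>h \<bullet> v\<bar> \<le> norm h" if "v \<in> Basis" for v
      using Basis_le_norm[OF that] .
    have "\<bar>f (x + (\<Sum>v\<in>B. (h \<bullet> v) *\<^sub>R v)) - f x - (\<Sum>v\<in>B. a v * (h \<bullet> v))\<bar>
        \<le> card B * ((2 * L * ?n + 1) * e * norm h)" if "B \<subseteq> Basis" for B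
      using finite_subset[OF that finite_Basis] that
    proof (induction B rule: finite_induct)
      case (insert v B)
      then have v: "v \<in> Basis" and B: "B \<subseteq> Basis" by auto
      define p where "p = x + (\<Sum>v\<in>B. (h \<bullet> v) *\<^sub>R v)"
      define s where "s = h \<bullet> v"
      have s: "\<bar>s\<bar> \<le> norm h" using coord[OF v] by (simp add: s_def)
      have "norm (p - x) \<le> (\<Sum>v\<in>B. norm ((h \<bullet> v) *\<^sub>R v))"
        unfolding p_def add_diff_cancel_left' by (rule norm_sum)
      also have "\<dots> \<le> (\<Sum>v\<in>B. norm h)"
        using B coord by (intro sum_mono) (auto simp: subset_iff)
      also have "\<dots> \<le> ?n * norm h"
        using card_mono[OF finite_Basis B] by (simp add: mult_right_mono)
      finally have px: "norm (p - x) \<le> ?n * norm h" .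
      also have "\<dots> < d v"
      proof -
        have "norm h < d v / ?n" using h \<delta>'(1)[OF v] by linarith
        then show ?thesis by (simp add: field_simps)
      qed
      finally obtain q where q: "q \<in> slope_set f v e (a v) (N v)" "norm (q - p) \<le> e * norm (p - x)"
        using near[OF v] by blast
      have qp: "norm (q - p) \<le> e * (?n * norm h)"
        using q(2) px e by (meson mult_left_mono order_trans less_imp_le)
      have "\<bar>s\<bar> < 1 / real (Suc (N v))"
        using s h \<delta>'(2)[OF v] by linarith
      then have "\<bar>f (q + s *\<^sub>R v) - f q - a v * s\<bar> \<le> e * \<bar>s\<bar>"
        using q(1) by (simp add: slope_set_def)
      also have "\<dots> \<le> e * norm h"
        using s e by (intro mult_left_mono) auto
      finally have 1: "\<bar>f (q + s *\<^sub>R v) - f q - a v * s\<bar> \<le> e * norm h" .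
      have "\<bar>f (p + s *\<^sub>R v) - f (q + s *\<^sub>R v)\<bar> \<le> L * norm (p - q)" "\<bar>f q - f p\<bar> \<le> L * norm (q - p)"
        using Lip[of "p + s *\<^sub>R v" "q + s *\<^sub>R v"] Lip[of q p] by simp_all
      moreover have "L * norm (q - p) \<le> L * (e * (?n * norm h))"
        using qp L by (rule mult_left_mono)
      ultimately have "\<bar>f (p + s *\<^sub>R v) - f p - a v * s\<bar> \<le> 2 * (L * (e * (?n * norm h))) + e * norm h"
        using 1 by (simp add: norm_minus_commute)
      also have "\<dots> = (2 * L * ?n + 1) * e * norm h"
        by (simp add: algebra_simps)
      finally have step: "\<bar>f (p + s *\<^sub>R v) - f p - a v * s\<bar> \<le> (2 * L * ?n + 1) * e * norm h" .
      have IH: "\<bar>f p - f x - (\<Sum>v\<in>B. a v * (h \<bullet> v))\<bar> \<le> card B * ((2 * L * ?n + 1) * e * norm h)"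
        using insert B by (simp add: p_def)
      have sums: "x + (\<Sum>v\<in>insert v B. (h \<bullet> v) *\<^sub>R v) = p + s *\<^sub>R v"
        "(\<Sum>v\<in>insert v B. a v * (h \<bullet> v)) = a v * s + (\<Sum>v\<in>B. a v * (h \<bullet> v))"
        using insert by (simp_all add: p_def s_def)
      have count: "real (card (insert v B)) * ((2 * L * ?n + 1) * e * norm h)
          = (2 * L * ?n + 1) * e * norm h + real (card B) * ((2 * L * ?n + 1) * e * norm h)"
        using insert by (simp add: distrib_right)
      show ?case
        unfolding sums count using step IH by linarith
    qed simp
    from this[OF order_refl] have "\<bar>f (x + (\<Sum>v\<in>Basis. (h \<bullet> v) *\<^sub>R v)) - f x - (\<Sum>v\<in>Basis. a v * (h \<bullet> v))\<bar>
        \<le> ?n * ((2 * L * ?n + 1) * e * norm h)" .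
    moreover have "(\<Sum>v\<in>Basis. a v * (h \<bullet> v)) = (\<Sum>v\<in>Basis. a v *\<^sub>R v) \<bullet> h"
      by (simp add: inner_sum_left inner_commute[of h])
    ultimately show ?thesis
      by (simp only: euclidean_representation mult.assoc)
  qed
  with \<delta> show ?thesis by blast
qed

text \<open>Half of the tolerance pays for replacing the derivative by a rational number, the other
  half for the error of the linear approximation.\<close>

lemma slope_set_if_differentiable_on_line:
  fixes f :: "'a::euclidean_space \<Rightarrow> real"
  assumes diff: "(\<lambda>s. f (x + s *\<^sub>R v)) differentiable (at t)" and e: "0 < e"
  shows "\<exists>a\<in>\<rat>. \<exists>N. x + t *\<^sub>R v \<in> slope_set f v e a N"
proof -
  obtain D where D: "((\<lambda>s. f (x + s *\<^sub>R v)) has_derivative (\<lambda>h. h * D)) (at t)"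
    using diff real_differentiable_def by (auto simp: has_field_derivative_def mult_commute_abs)
  obtain a where a: "a \<in> \<rat>" "D < a" "a < D + e / 2"
    using Rats_dense_in_real[of D "D + e / 2"] e by auto
  have "0 < e / 2" using e by simp
  with D obtain d where d: "0 < d" and der: "\<And>y. norm (y - t) < d \<Longrightarrow>
      norm (f (x + y *\<^sub>R v) - f (x + t *\<^sub>R v) - (y - t) * D) \<le> e / 2 * norm (y - t)"
    unfolding has_derivative_at_alt by blast
  obtain N where N: "1 / real (Suc N) < d"
    using d by (rule nat_approx_posE)
  have "\<bar>f (x + t *\<^sub>R v + s *\<^sub>R v) - f (x + t *\<^sub>R v) - a * s\<bar> \<le> e * \<bar>s\<bar>" if "\<bar>s\<bar> < 1 / real (Suc N)" for s
  proof -
    have "\<bar>f (x + (t + s) *\<^sub>R v) - f (x + t *\<^sub>R v) - s * D\<bar> \<le> e / 2 * \<bar>s\<bar>"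
      using der[of "t + s"] that N by simp
    moreover have "\<bar>s * D - a * s\<bar> \<le> e / 2 * \<bar>s\<bar>"
    proof -
      have "\<bar>s * D - a * s\<bar> = \<bar>D - a\<bar> * \<bar>s\<bar>"
        by (simp add: abs_mult[symmetric] algebra_simps)
      also have "\<dots> \<le> e / 2 * \<bar>s\<bar>"
        using a by (intro mult_right_mono) auto
      finally show ?thesis .
    qed
    moreover have "f (x + t *\<^sub>R v + s *\<^sub>R v) = f (x + (t + s) *\<^sub>R v)"
      by (simp add: algebra_simps)
    moreover have "e / 2 * \<bar>s\<bar> + e / 2 * \<bar>s\<bar> = e * \<bar>s\<bar>"
      by simp
    ultimately show ?thesis
      by linarith
  qed
  with a show ?thesis
    unfolding slope_set_def by blast
qed

theorem Rademacher_real: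
  fixes f :: "'a::euclidean_space \<Rightarrow> real"
  assumes lip: "L-lipschitz_on UNIV f"
  shows "negligible {x. \<not> f differentiable (at x)}"
proof -
  let ?P = "\<lambda>v k a N. slope_set f v (1 / real (Suc k)) a N"
  let ?n = "real DIM('a)"
  have L: "0 \<le> L" using lip by (rule lipschitz_on_nonneg)
  have cont: "continuous_on UNIV f" using lip by (rule lipschitz_on_continuous_on)
  \<comment> \<open>\<open>X v k\<close> is where no rational slope works at tolerance 1/(k+1); it
    meets each line parallel to v in a null set. \<open>Y\<close> removes from each slope set its
    points of density other than 1. Rational slopes keep the union of all bad sets
    countable.\<close>
  define X where "X v k = - (\<Union>a\<in>\<rat>. \<Union>N. ?P v k a N)" for v k
  define Y where "Y v k a N = {x \<in> ?P v k a N. \<not> has_lebesgue_density (?P v k a N) x 1}" for v k a N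
  have Pb: "?P v k a N \<in> sets borel" for v k a N
    by (intro borel_closed closed_slope_set cont)
  have X: "negligible (X v k)" if v: "v \<in> Basis" for v k
  proof (rule negligible_if_negligible_on_lines)
    have "(\<Union>a\<in>\<rat>. \<Union>N. ?P v k a N) \<in> sets borel"
      using Pb by (intro sets.countable_UN' countable_rat sets.countable_UN) auto
    then show "X v k \<in> sets borel"
      unfolding X_def by (rule borel_comp)
    fix x
    have "L-lipschitz_on UNIV (\<lambda>s. f (x + s *\<^sub>R v))"
    proof (rule lipschitz_onI[OF _ L])
      fix s t :: real
      have "dist (f (x + s *\<^sub>R v)) (f (x + t *\<^sub>R v)) \<le> L * dist (x + s *\<^sub>R v) (x + t *\<^sub>R v)"
        using lip by (rule lipschitz_onD) auto
      also have "dist (x + s *\<^sub>R v) (x + t *\<^sub>R v) = dist s t"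
        using v by (simp add: dist_norm scaleR_diff_left[symmetric])
      finally show "dist (f (x + s *\<^sub>R v)) (f (x + t *\<^sub>R v)) \<le> L * dist s t" .
    qed
    then have "negligible {t. \<not> (\<lambda>s. f (x + s *\<^sub>R v)) differentiable (at t)}"
      by (rule negligible_not_differentiable_real)
    moreover have "{t. x + t *\<^sub>R v \<in> X v k} \<subseteq> {t. \<not> (\<lambda>s. f (x + s *\<^sub>R v)) differentiable (at t)}"
    proof safe
      fix t assume "x + t *\<^sub>R v \<in> X v k" "(\<lambda>s. f (x + s *\<^sub>R v)) differentiable (at t)"
      with slope_set_if_differentiable_on_line[of f x v t "1 / real (Suc k)"] show False
        unfolding X_def by auto
    qed
    ultimately show "negligible {t. x + t *\<^sub>R v \<in> X v k}"
      by (rule negligible_subset)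
  qed
  have Y: "negligible (Y v k a N)" for v k a N
    unfolding Y_def using Pb by (intro negligible_not_density_1) auto
  let ?Bad = "(\<Union>v\<in>Basis. \<Union>k. X v k) \<union> (\<Union>v\<in>Basis. \<Union>k. \<Union>a\<in>\<rat>. \<Union>N. Y v k a N)"
  have "negligible ?Bad"
    using X Y by (intro negligible_Un negligible_UN_countable countable_rat countable_finite[OF finite_Basis]) auto
  moreover have "f differentiable (at x)" if x: "x \<notin> ?Bad" for x
  proof (rule differentiable_if_almost_linear)
    fix e :: real assume e: "0 < e"
    \<comment> \<open>This is the factor by which \<open>slope_set_density_almost_linear\<close>
      enlarges the tolerance.\<close>
    define c where "c = ?n * (2 * L * ?n + 1)"
    have c: "0 < c" using L by (simp add: c_def add_nonneg_pos)
    then have "0 < e / c" using e by simp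
    then obtain k where k: "1 / real (Suc k) < e / c" by (rule nat_approx_posE)
    have "\<exists>a N. x \<in> ?P v k a N \<and> has_lebesgue_density (?P v k a N) x 1" if v: "v \<in> Basis" for v
    proof -
      have "x \<notin> X v k" using x v by blast
      then obtain a N where aN: "a \<in> \<rat>" "x \<in> ?P v k a N" unfolding X_def by blast
      have "x \<notin> Y v k a N"
      proof
        assume "x \<in> Y v k a N"
        then have "x \<in> (\<Union>v\<in>Basis. \<Union>k. \<Union>a\<in>\<rat>. \<Union>N. Y v k a N)"
          by (intro UN_I[OF v] UN_I[OF UNIV_I] UN_I[OF aN(1)])
        with x show False by (simp only: Un_iff) simp
      qed
      then have "has_lebesgue_density (?P v k a N) x 1"
        using aN(2) by (simp add: Y_def)
      with aN(2) show ?thesis by (intro exI conjI)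
    qed
    then obtain a N where aN: "\<And>v. v \<in> Basis \<Longrightarrow> x \<in> ?P v k (a v) (N v)"
      "\<And>v. v \<in> Basis \<Longrightarrow> has_lebesgue_density (?P v k (a v) (N v)) x 1"
      by metis
    have "0 < 1 / real (Suc k)" by simp
    from slope_set_density_almost_linear[OF lip this aN]
    obtain d where d: "d > 0" and le: "\<And>h. norm h < d \<Longrightarrow>
        \<bar>f (x + h) - f x - (\<Sum>v\<in>Basis. a v *\<^sub>R v) \<bullet> h\<bar> \<le> ?n * ((2 * L * ?n + 1) * (1 / real (Suc k))) * norm h"
      by blast
    have "?n * ((2 * L * ?n + 1) * (1 / real (Suc k))) \<le> e"
    proof -
      have "c * (1 / real (Suc k)) \<le> c * (e / c)"
        using k c by (intro mult_left_mono) auto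
      also have "c * (e / c) = e" using c by simp
      finally show ?thesis by (simp only: c_def mult.assoc)
    qed
    then have "\<bar>f (x + h) - f x - (\<Sum>v\<in>Basis. a v *\<^sub>R v) \<bullet> h\<bar> \<le> e * norm h" if "norm h < d" for h
      using le[OF that] by (meson mult_right_mono norm_ge_zero order_trans)
    with d show "\<exists>a d. 0 < d \<and> (\<forall>h. norm h < d \<longrightarrow> \<bar>f (x + h) - f x - a \<bullet> h\<bar> \<le> e * norm h)"
      by blast
  qed
  ultimately show ?thesis
    by (elim negligible_subset) blast
qed

text \<open>Each cone \<open>f a + L * dist x a\<close> is L-Lipschitz in x, lies above f on S, and
  equals f at its apex a. The infimum of the cones therefore keeps the constant L and agrees with f
  on S.\<close>

lemma McShane_extension:
  fixes f :: "'a::metric_space \<Rightarrow> real"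
  assumes lip: "L-lipschitz_on S f"
  obtains g where "L-lipschitz_on UNIV g" "\<And>x. x \<in> S \<Longrightarrow> g x = f x"
proof (cases "S = {}")
  \<comment> \<open>For empty S there is no cone to take an infimum of; the zero function
    serves.\<close>
  case True
  then show ?thesis
    using that[of "\<lambda>x. 0"] lipschitz_on_nonneg[OF lip] by (simp add: lipschitz_on_def)
next
  case False
  then obtain c where c: "c \<in> S" by blast
  have L: "0 \<le> L" using lip by (rule lipschitz_on_nonneg)
  have Lip: "f x - f y \<le> L * dist x y" if "x \<in> S" "y \<in> S" for x y
    using lipschitz_onD[OF lip that] by (simp add: dist_real_def abs_le_iff)
  define g where "g x = (INF a\<in>S. f a + L * dist x a)" for x
  have bdd: "bdd_below ((\<lambda>a. f a + L * dist x a) ` S)" for x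
  proof (rule bdd_belowI2)
    fix a assume a: "a \<in> S"
    have "f c - f a \<le> L * dist c a" using Lip[OF c a] .
    also have "\<dots> \<le> L * (dist x c + dist x a)"
      using L dist_triangle[of c a x] by (intro mult_left_mono) (auto simp: dist_commute)
    finally show "f c - L * dist x c \<le> f a + L * dist x a"
      by (simp add: algebra_simps)
  qed
  have one: "g x - g y \<le> L * dist x y" for x y
  proof -
    have "g x - L * dist x y \<le> g y"
      unfolding g_def[of y]
    proof (rule cINF_greatest[OF False])
      fix a assume a: "a \<in> S"
      have "g x \<le> f a + L * dist x a"
        unfolding g_def by (rule cINF_lower[OF bdd a])
      also have "\<dots> \<le> f a + L * (dist x y + dist y a)"
        using L by (intro add_left_mono mult_left_mono dist_triangle)
      finally show "g x - L * dist x y \<le> f a + L * dist y a"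
        by (simp add: algebra_simps)
    qed
    then show ?thesis by simp
  qed
  show ?thesis
  proof
    show "L-lipschitz_on UNIV g"
    proof (rule lipschitz_onI[OF _ L])
      fix x y show "dist (g x) (g y) \<le> L * dist x y"
        using one[of x y] one[of y x] by (simp add: dist_real_def abs_le_iff dist_commute)
    qed
    fix x assume x: "x \<in> S"
    show "g x = f x"
    proof (rule antisym)
      show "g x \<le> f x"
        unfolding g_def using cINF_lower[OF bdd x, of x] by simp
      show "f x \<le> g x"
        unfolding g_def
      proof (rule cINF_greatest[OF False])
        fix a assume "a \<in> S"
        then show "f x \<le> f a + L * dist x a" using Lip[OF x] by force
      qed
    qed
  qed
qed

text \<open>The extension is available for real values, so f is treated coordinate by coordinate;
  each coordinate is again L-Lipschitz, and differentiability of all extensions at x restricts to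
  S.\<close>

theorem Rademacher_within:
  fixes f :: "'a::euclidean_space \<Rightarrow> 'b::euclidean_space"
  assumes lip: "L-lipschitz_on S f"
  shows "negligible {x \<in> S. \<not> f differentiable (at x within S)}"
proof -
  have "\<exists>g. L-lipschitz_on UNIV g \<and> (\<forall>x\<in>S. g x = f x \<bullet> i)" if "i \<in> Basis" for i
  proof -
    have "L-lipschitz_on S (\<lambda>x. f x \<bullet> i)"
    proof (rule lipschitz_onI)
      fix x y assume xy: "x \<in> S" "y \<in> S"
      have "dist (f x \<bullet> i) (f y \<bullet> i) \<le> dist (f x) (f y)"
        unfolding dist_norm inner_diff_left[symmetric] real_norm_def by (rule Basis_le_norm[OF that])
      also have "\<dots> \<le> L * dist x y" using lip xy by (rule lipschitz_onD)
      finally show "dist (f x \<bullet> i) (f y \<bullet> i) \<le> L * dist x y" .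
    qed (rule lipschitz_on_nonneg[OF lip])
    then show ?thesis
      by (rule McShane_extension) blast
  qed
  then obtain g where g: "\<And>i. i \<in> Basis \<Longrightarrow> L-lipschitz_on UNIV (g i)"
    "\<And>i x. i \<in> Basis \<Longrightarrow> x \<in> S \<Longrightarrow> g i x = f x \<bullet> i"
    by metis
  have "negligible (\<Union>i\<in>Basis. {x. \<not> g i differentiable (at x)})"
    using g(1) by (intro negligible_UN_countable Rademacher_real countable_finite[OF finite_Basis]) auto
  moreover have "f differentiable (at x within S)"
    if x: "x \<in> S" "x \<notin> (\<Union>i\<in>Basis. {x. \<not> g i differentiable (at x)})" for x
    unfolding differentiable_componentwise_within[of f]
  proof
    fix i :: 'b assume i: "i \<in> Basis"
    with x have "g i differentiable (at x within S)"
      by (auto intro: differentiable_at_withinI)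
    then show "(\<lambda>x. f x \<bullet> i) differentiable (at x within S)"
      by (rule differentiable_transform_within[OF _ zero_less_one x(1)]) (use g(2)[OF i] in auto)
  qed
  ultimately show ?thesis
    by (elim negligible_subset) blast
qed

subsection \<open>Approximate derivatives\<close>

lemma has_lebesgue_density_1_Diff:
  assumes "has_lebesgue_density A x 1" "has_lebesgue_density B x 0"
  shows "has_lebesgue_density (A - B) x 1"
proof -
  let ?q = "\<lambda>E r. measure lebesgue (E \<inter> ball x r) / measure lebesgue (ball x r)"
  have A: "A \<in> sets lebesgue" and limA: "(?q A \<longlongrightarrow> 1) (at_right 0)"
    and B: "B \<in> sets lebesgue" and limB: "(?q B \<longlongrightarrow> 0) (at_right 0)"
    using assms by (auto simp: has_lebesgue_density_def)
  have lim: "((\<lambda>r. ?q A r - ?q B r) \<longlongrightarrow> 1) (at_right 0)"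
    using tendsto_diff[OF limA limB] by simp
  have AB: "A - B \<in> sets lebesgue" using A B by simp
  have "?q A r - ?q B r \<le> ?q (A - B) r" for r
  proof -
    have "measure lebesgue (A \<inter> ball x r) \<le> measure lebesgue (((A - B) \<inter> ball x r) \<union> (B \<inter> ball x r))"
      using fmeasurable.Un[OF lmeasurable_Int_ball[OF AB] lmeasurable_Int_ball[OF B]]
        fmeasurableD[OF lmeasurable_Int_ball[OF A]]
      by (intro measure_mono_fmeasurable) auto
    also have "\<dots> \<le> measure lebesgue ((A - B) \<inter> ball x r) + measure lebesgue (B \<inter> ball x r)"
      by (rule measure_Un_le[OF fmeasurableD[OF lmeasurable_Int_ball[OF AB]]
            fmeasurableD[OF lmeasurable_Int_ball[OF B]]])
    finally show ?thesis
      unfolding diff_divide_distrib[symmetric] by (intro divide_right_mono) auto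
  qed
  then show ?thesis
    unfolding has_lebesgue_density_def
    using density_ratio_le_1[OF AB]
    by (intro conjI AB tendsto_sandwich[OF _ _ lim tendsto_const]) auto
qed

text \<open>Without the two exceptional sets A still has density 1 at x, so it has a point q within
  \<epsilon> s |w| of y = x + s w. As |q - x| \<le> 2 s |w|, both maps approximate the increment at
  q and differ there by at most 4 \<epsilon> s |w|; passing from q to y costs K \<epsilon> s |w|.
  Dividing by s leaves the factor 4 + K.\<close>

lemma has_approx_derivative_unique:
  fixes \<phi> :: "'a::euclidean_space \<Rightarrow> 'b::real_normed_vector"
  assumes 1: "has_approx_derivative A \<phi> x L1" and 2: "has_approx_derivative A \<phi> x L2"
  shows "L1 = L2"
proof
  fix w
  define D where "D z = L1 z - L2 z" for z
  have lin: "linear D"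
    using 1 2 unfolding D_def[abs_def] has_approx_derivative_def by (intro linear_compose_sub) auto
  then obtain K where K: "0 < K" "\<And>z. norm (D z) \<le> K * norm z"
    using linear_bounded_pos by blast
  have bound: "norm (D w) \<le> \<epsilon> * ((4 + K) * norm w)" if \<epsilon>: "0 < \<epsilon>" "\<epsilon> \<le> 1" for \<epsilon>
  proof (cases "w = 0")
    case True
    then show ?thesis using linear_0[OF lin] by simp
  next
    case False
    let ?B = "\<lambda>L. {z \<in> A. norm (\<phi> z - \<phi> x - L (z - x)) > \<epsilon> * norm (z - x)}"
    have "has_lebesgue_density ((A - ?B L1) - ?B L2) x 1"
      using 1 2 \<epsilon> unfolding has_approx_derivative_def by (intro has_lebesgue_density_1_Diff) auto
    then obtain d where d: "0 < d" and near: "\<And>y. norm (y - x) < d \<Longrightarrow> y \<noteq> x \<Longrightarrow>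
        \<exists>q\<in>(A - ?B L1) - ?B L2. norm (q - y) \<le> \<epsilon> * norm (y - x)"
      using density_1_near[OF _ \<epsilon>(1)] by blast
    define s where "s = d / (2 * norm w)"
    have s: "0 < s" "norm (s *\<^sub>R w) < d"
      using d False by (auto simp: s_def)
    define y where "y = x + s *\<^sub>R w"
    have y: "norm (y - x) = s * norm w" "norm (y - x) < d" "y \<noteq> x"
      using s False by (auto simp: y_def)
    then obtain q where q: "q \<in> (A - ?B L1) - ?B L2" "norm (q - y) \<le> \<epsilon> * (s * norm w)"
      using near[of y] by auto
    have "norm (\<phi> q - \<phi> x - L1 (q - x)) \<le> \<epsilon> * norm (q - x)" "norm (\<phi> q - \<phi> x - L2 (q - x)) \<le> \<epsilon> * norm (q - x)"
      using q(1) by (auto simp: not_less)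
    moreover have "D (q - x) = (\<phi> q - \<phi> x - L2 (q - x)) - (\<phi> q - \<phi> x - L1 (q - x))"
      by (simp add: D_def)
    ultimately have Dq: "norm (D (q - x)) \<le> 2 * (\<epsilon> * norm (q - x))"
      using norm_triangle_ineq4[of "\<phi> q - \<phi> x - L2 (q - x)" "\<phi> q - \<phi> x - L1 (q - x)"] by simp
    have "\<epsilon> * (s * norm w) \<le> s * norm w"
      using \<epsilon> s by (intro mult_left_le_one_le) auto
    then have "norm (q - x) \<le> 2 * (s * norm w)"
      using norm_triangle_ineq[of "q - y" "y - x"] q(2) y(1) by simp
    then have "\<epsilon> * norm (q - x) \<le> \<epsilon> * (2 * (s * norm w))"
      using \<epsilon> by (intro mult_left_mono) auto
    with Dq have 1: "norm (D (q - x)) \<le> 4 * (\<epsilon> * (s * norm w))" by simp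
    have "norm (D (q - y)) \<le> K * norm (q - y)" by (rule K)
    also have "\<dots> \<le> K * (\<epsilon> * (s * norm w))"
      using K q by (intro mult_left_mono) auto
    finally have 2: "norm (D (q - y)) \<le> K * (\<epsilon> * (s * norm w))" .
    have "s *\<^sub>R D w = D (q - x) - D (q - y)"
      using lin by (simp add: linear_diff[symmetric] linear_cmul[symmetric] y_def)
    then have "norm (s *\<^sub>R D w) \<le> 4 * (\<epsilon> * (s * norm w)) + K * (\<epsilon> * (s * norm w))"
      using norm_triangle_ineq4[of "D (q - x)" "D (q - y)"] 1 2 by simp
    then have "s * norm (D w) \<le> s * (\<epsilon> * ((4 + K) * norm w))"
      using s by (simp add: algebra_simps)
    then show ?thesis using s by simp
  qed
  have "norm (D w) \<le> 0 + e" if e: "0 < e" for e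
  proof -
    \<comment> \<open>The summand 1 keeps the divisor positive when w = 0.\<close>
    define c where "c = (4 + K) * norm w + 1"
    have c: "0 < c" "(4 + K) * norm w \<le> c" using K by (auto simp: c_def add_nonneg_pos)
    have "norm (D w) \<le> min 1 (e / c) * ((4 + K) * norm w)"
      using e c by (intro bound) auto
    also have "\<dots> \<le> e / c * c"
      using e c K by (intro mult_mono) auto
    finally show ?thesis using c by simp
  qed
  then have "norm (D w) \<le> 0" by (rule field_le_epsilon)
  then show "L1 w = L2 w" by (simp add: D_def)
qed

lemma approx_derivative_eq:
  assumes "has_approx_derivative A \<phi> x L"
  shows "approx_derivative A \<phi> x = L"
  unfolding approx_derivative_def using assms has_approx_derivative_unique by blast

text \<open>Nothing is known about phi on A - S, so exceptional points may accumulate at x; but near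
  x they all lie outside S, and that part of a small ball is negligible in proportion. Measurability
  of phi makes the exceptional set Lebesgue, as the notion of density demands.\<close>

lemma has_approx_derivative_if_has_derivative_within:
  fixes \<phi> :: "'a::euclidean_space \<Rightarrow> 'b::euclidean_space"
  assumes A: "A \<in> sets lebesgue" and \<phi>: "\<phi> \<in> borel_measurable (lebesgue_on A)"
    and S: "S \<subseteq> A" "has_lebesgue_density S x 1" and x: "x \<in> A"
    and der: "(\<phi> has_derivative L) (at x within S)"
  shows "has_approx_derivative A \<phi> x L"
  unfolding has_approx_derivative_def
proof (intro conjI allI impI x)
  show "has_lebesgue_density A x 1"
    by (rule has_lebesgue_density_1_mono[OF S(1) A S(2)])
  have bl: "bounded_linear L" using der by (rule has_derivative_bounded_linear)
  then show "linear L" by (rule bounded_linear.linear)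
  fix \<epsilon> :: real assume \<epsilon>: "0 < \<epsilon>"
  let ?E = "{z \<in> A. norm (\<phi> z - \<phi> x - L (z - x)) > \<epsilon> * norm (z - x)}"
  obtain d where d: "0 < d" and small: "\<And>z. z \<in> S \<Longrightarrow> norm (z - x) < d \<Longrightarrow>
      norm (\<phi> z - \<phi> x - L (z - x)) \<le> \<epsilon> * norm (z - x)"
    using der \<epsilon> unfolding has_derivative_within_alt by blast
  show "has_lebesgue_density ?E x 0"
  proof (rule has_lebesgue_density_0_disjoint[OF S(2) _ d])
    show "?E \<inter> S \<inter> ball x d = {}"
      using small by (force simp: dist_norm norm_minus_commute)
    have L: "(\<lambda>z. L (z - x)) \<in> borel_measurable (lebesgue_on A)"
    proof -
      have "(\<lambda>z. L (z - x)) \<in> borel_measurable borel"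
        by (intro borel_measurable_continuous_onI bounded_linear.continuous_on[OF bl] continuous_intros)
      then show ?thesis
        by (intro measurable_restrict_space1 measurable_completion) simp
    qed
    have N: "(\<lambda>z. \<epsilon> * norm (z - x)) \<in> borel_measurable (lebesgue_on A)"
      by (intro measurable_restrict_space1 measurable_completion) simp
    have "{z \<in> space (lebesgue_on A). \<epsilon> * norm (z - x) < norm (\<phi> z - \<phi> x - L (z - x))} \<in> sets (lebesgue_on A)"
      using \<phi> L N by (intro borel_measurable_less borel_measurable_norm borel_measurable_diff) auto
    then show "?E \<in> sets lebesgue"
      using A by (simp add: sets_restrict_space_iff)
  qed
qed

subsection \<open>Area formula\<close>

text \<open>The finite partial sums are integrals of restrictions of g. Conversely, if some level
  set g \<ge> 1/(n+1) is infinite, the sum is infinite; otherwise these finite level sets increase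
  to the support of g and monotone convergence applies, even for uncountable
  \<open>B\<close>.\<close>

lemma infsum_eq_nn_integral_count_space:
  fixes g :: "'a \<Rightarrow> ennreal"
  shows "(\<Sum>\<^sub>\<infinity>x\<in>B. g x) = (\<integral>\<^sup>+x. g x \<partial>count_space B)"
proof (rule antisym)
  have SUP: "(\<Sum>\<^sub>\<infinity>x\<in>B. g x) = (SUP F\<in>{F. finite F \<and> F \<subseteq> B}. sum g F)"
    by (rule nonneg_infsum_complete) simp
  show "(\<Sum>\<^sub>\<infinity>x\<in>B. g x) \<le> (\<integral>\<^sup>+x. g x \<partial>count_space B)"
    unfolding SUP
  proof (rule SUP_least)
    fix F assume F: "F \<in> {F. finite F \<and> F \<subseteq> B}"
    then have "sum g F = (\<integral>\<^sup>+x. g x \<partial>count_space F)"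
      by (simp add: nn_integral_count_space_finite)
    also have "\<dots> = (\<integral>\<^sup>+x. g x * indicator F x \<partial>count_space UNIV)"
      by (rule nn_integral_count_space_indicator) simp
    also have "\<dots> \<le> (\<integral>\<^sup>+x. g x * indicator B x \<partial>count_space UNIV)"
      using F by (intro nn_integral_mono mult_left_mono) (auto simp: indicator_def)
    also have "\<dots> = (\<integral>\<^sup>+x. g x \<partial>count_space B)"
      by (rule nn_integral_count_space_indicator[symmetric]) simp
    finally show "sum g F \<le> (\<integral>\<^sup>+x. g x \<partial>count_space B)" .
  qed
  define F where "F n = {x \<in> B. ennreal (1 / real (Suc n)) \<le> g x}" for n
  show "(\<integral>\<^sup>+x. g x \<partial>count_space B) \<le> (\<Sum>\<^sub>\<infinity>x\<in>B. g x)"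
  proof (cases "\<forall>n. finite (F n)")
    case True
    have mono: "F m \<subseteq> F n" if "m \<le> n" for m n
    proof -
      have "ennreal (1 / real (Suc n)) \<le> ennreal (1 / real (Suc m))"
        using that by (intro ennreal_leI) (simp add: field_simps)
      then show ?thesis
        unfolding F_def by (blast intro: order_trans)
    qed
    have g: "g x = (SUP n. g x * indicator (F n) x)" if x: "x \<in> B" for x
    proof (cases "g x = 0")
      case False
      have "\<exists>n. x \<in> F n"
      proof (cases "g x")
        case (real r)
        with False have "0 < r" by (simp add: less_le)
        then obtain n where "1 / real (Suc n) < r" by (rule nat_approx_posE)
        then show ?thesis using real x by (auto simp: F_def intro!: exI[of _ n] ennreal_leI)
      next
        case top
        then show ?thesis using x by (auto simp: F_def)
      qed
      then obtain n where n: "x \<in> F n" by blast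
      show ?thesis
      proof (rule antisym)
        show "g x \<le> (SUP n. g x * indicator (F n) x)"
          using n by (intro SUP_upper2[of n]) auto
        show "(SUP n. g x * indicator (F n) x) \<le> g x"
          by (rule SUP_least) (simp add: indicator_def)
      qed
    qed simp
    have "(\<integral>\<^sup>+x. g x \<partial>count_space B) = (\<integral>\<^sup>+x. (SUP n. g x * indicator (F n) x) \<partial>count_space B)"
      using g by (intro nn_integral_cong) simp
    also have "\<dots> = (SUP n. \<integral>\<^sup>+x. g x * indicator (F n) x \<partial>count_space B)"
    proof (rule nn_integral_monotone_convergence_SUP)
      show "incseq (\<lambda>n x. g x * indicator (F n) x)"
        using mono by (auto simp: incseq_def le_fun_def indicator_def)
    qed simp
    also have "\<dots> \<le> (\<Sum>\<^sub>\<infinity>x\<in>B. g x)"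
    proof (rule SUP_least)
      fix n
      have FB: "F n \<subseteq> B" by (auto simp: F_def)
      have "(\<integral>\<^sup>+x. g x * indicator (F n) x \<partial>count_space B) = (\<Sum>x\<in>F n. g x * indicator (F n) x)"
        using True FB by (intro nn_integral_count_space') (auto simp: indicator_def)
      also have "\<dots> = sum g (F n)"
        by (intro sum.cong) auto
      also have "\<dots> \<le> (\<Sum>\<^sub>\<infinity>x\<in>B. g x)"
        unfolding SUP using True FB by (intro SUP_upper) auto
      finally show "(\<integral>\<^sup>+x. g x * indicator (F n) x \<partial>count_space B) \<le> (\<Sum>\<^sub>\<infinity>x\<in>B. g x)" .
    qed
    finally show ?thesis .
  next
    case False
    then obtain n where "infinite (F n)" by blast
    then have "(\<Sum>\<^sub>\<infinity>x\<in>F n. g x) = \<infinity>"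
      by (intro infsum_superconst_infinite_ennreal[of "F n" "ennreal (1 / real (Suc n))"]) (auto simp: F_def)
    moreover have "(\<Sum>\<^sub>\<infinity>x\<in>F n. g x) \<le> (\<Sum>\<^sub>\<infinity>x\<in>B. g x)"
      by (rule infsum_mono_neutral) (auto simp: F_def nonneg_summable_on_complete)
    ultimately show ?thesis by (simp add: top_unique)
  qed
qed

text \<open>The induction over nonnegative measurable functions carries measurability of the fibre
  sum along with the identity, since integrating sums and suprema over y needs it.\<close>

lemma nn_integral_fibre_sum:
  fixes M :: "'a measure" and M' :: "'b measure" and \<phi> :: "'a \<Rightarrow> 'b" and J f :: "'a \<Rightarrow> ennreal"
  assumes J: "J \<in> borel_measurable M"
    and \<C>: "countable \<C>" "\<C> \<subseteq> sets M" "space M = \<Union>\<C>"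
    and piece: "\<And>C D. D \<in> \<C> \<Longrightarrow> C \<in> sets M \<Longrightarrow> C \<subseteq> D \<Longrightarrow>
      (\<lambda>y. \<integral>\<^sup>+x. indicator C x \<partial>count_space {x \<in> space M. \<phi> x = y}) \<in> borel_measurable M' \<and>
      (\<integral>\<^sup>+y. (\<integral>\<^sup>+x. indicator C x \<partial>count_space {x \<in> space M. \<phi> x = y}) \<partial>M') = (\<integral>\<^sup>+x. indicator C x * J x \<partial>M)"
    and f: "f \<in> borel_measurable M"
  shows "(\<lambda>y. \<integral>\<^sup>+x. f x \<partial>count_space {x \<in> space M. \<phi> x = y}) \<in> borel_measurable M' \<and>
    (\<integral>\<^sup>+y. (\<integral>\<^sup>+x. f x \<partial>count_space {x \<in> space M. \<phi> x = y}) \<partial>M') = (\<integral>\<^sup>+x. f x * J x \<partial>M)"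
    (is "?P f")
  using f
proof (induction rule: borel_measurable_induct)
  case (cong f g)
  have "(\<integral>\<^sup>+x. f x \<partial>count_space {x \<in> space M. \<phi> x = y}) = (\<integral>\<^sup>+x. g x \<partial>count_space {x \<in> space M. \<phi> x = y})" for y
    using cong(3) by (intro nn_integral_cong) auto
  moreover have "(\<integral>\<^sup>+x. f x * J x \<partial>M) = (\<integral>\<^sup>+x. g x * J x \<partial>M)"
    using cong(3) by (intro nn_integral_cong) auto
  ultimately show ?case using cong(4) by simp
next
  case (set C)
  \<comment> \<open>Adding the empty set makes the enumeration possible also when
    \<open>\<C>\<close> is empty.\<close>
  define E where "E = from_nat_into (insert {} \<C>)"
  have E: "range E = insert {} \<C>"
    unfolding E_def using \<C>(1) by (intro range_from_nat_into) auto
  have Es: "E k \<in> sets M" for k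
    using E \<C>(2) by (metis insert_iff rangeI sets.empty_sets subsetD)
  \<comment> \<open>Making the pieces disjoint produces sets that need not be members of
    \<open>\<C>\<close>; this is why \<open>piece\<close> is assumed for all measurable subsets of a
    member.\<close>
  define Ck where "Ck k = C \<inter> disjointed E k" for k
  have Ck: "Ck k \<in> sets M" for k
    using set Es sets.range_disjointed_sets[of E M] by (auto simp: Ck_def)
  have good: "?P (indicator (Ck k))" for k
  proof (cases "E k = {}")
    case True
    then have "Ck k = {}" using disjointed_subset[of E k] by (auto simp: Ck_def)
    then show ?thesis by simp
  next
    case False
    then have "E k \<in> \<C>" using E by blast
    then show ?thesis
      using disjointed_subset[of E k] by (intro piece Ck) (auto simp: Ck_def)
  qed
  have UE: "(\<Union>k. E k) = space M"
    unfolding E using \<C>(3) by simp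
  have "(\<Union>k. Ck k) = C"
    using sets.sets_into_space[OF set] UE by (auto simp: Ck_def UN_disjointed_eq Int_UN_distrib[symmetric])
  moreover have "disjoint_family Ck"
    unfolding Ck_def using disjoint_family_disjointed[of E] by (auto simp: disjoint_family_on_def)
  ultimately have ind: "indicator C x = (\<Sum>k. indicator (Ck k) x :: ennreal)" for x
    by (metis suminf_indicator)
  have sum: "(\<integral>\<^sup>+x. indicator C x \<partial>count_space {x \<in> space M. \<phi> x = y})
      = (\<Sum>k. \<integral>\<^sup>+x. indicator (Ck k) x \<partial>count_space {x \<in> space M. \<phi> x = y})" for y
    unfolding ind by (rule nn_integral_suminf) simp
  have "(\<integral>\<^sup>+y. (\<integral>\<^sup>+x. indicator C x \<partial>count_space {x \<in> space M. \<phi> x = y}) \<partial>M')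
      = (\<Sum>k. \<integral>\<^sup>+y. (\<integral>\<^sup>+x. indicator (Ck k) x \<partial>count_space {x \<in> space M. \<phi> x = y}) \<partial>M')"
    unfolding sum using good by (intro nn_integral_suminf) blast
  also have "\<dots> = (\<Sum>k. \<integral>\<^sup>+x. indicator (Ck k) x * J x \<partial>M)"
    using good by simp
  also have "\<dots> = (\<integral>\<^sup>+x. (\<Sum>k. indicator (Ck k) x * J x) \<partial>M)"
    using J Ck by (intro nn_integral_suminf[symmetric]) auto
  also have "\<dots> = (\<integral>\<^sup>+x. indicator C x * J x \<partial>M)"
    unfolding ind by simp
  finally have eq: "(\<integral>\<^sup>+y. (\<integral>\<^sup>+x. indicator C x \<partial>count_space {x \<in> space M. \<phi> x = y}) \<partial>M')
      = (\<integral>\<^sup>+x. indicator C x * J x \<partial>M)" .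
  have "(\<lambda>y. \<integral>\<^sup>+x. indicator C x \<partial>count_space {x \<in> space M. \<phi> x = y}) \<in> borel_measurable M'"
    unfolding sum using good by (intro borel_measurable_suminf_order) blast
  with eq show ?case by (intro conjI)
next
  case (mult u c)
  have "(\<integral>\<^sup>+x. c * u x \<partial>count_space {x \<in> space M. \<phi> x = y}) = c * (\<integral>\<^sup>+x. u x \<partial>count_space {x \<in> space M. \<phi> x = y})" for y
    by (rule nn_integral_cmult) simp
  moreover have "(\<integral>\<^sup>+x. c * u x * J x \<partial>M) = c * (\<integral>\<^sup>+x. u x * J x \<partial>M)"
    using mult J by (simp add: mult.assoc nn_integral_cmult)
  moreover have u [measurable]: "(\<lambda>y. \<integral>\<^sup>+x. u x \<partial>count_space {x \<in> space M. \<phi> x = y}) \<in> borel_measurable M'"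
    using mult by blast
  moreover have "(\<lambda>y. c * (\<integral>\<^sup>+x. u x \<partial>count_space {x \<in> space M. \<phi> x = y})) \<in> borel_measurable M'"
    by measurable
  ultimately show ?case
    using mult by (simp add: nn_integral_cmult)
next
  case (add u v)
  have "(\<integral>\<^sup>+x. v x + u x \<partial>count_space {x \<in> space M. \<phi> x = y})
      = (\<integral>\<^sup>+x. v x \<partial>count_space {x \<in> space M. \<phi> x = y}) + (\<integral>\<^sup>+x. u x \<partial>count_space {x \<in> space M. \<phi> x = y})" for y
    by (rule nn_integral_add) simp_all
  moreover have "(\<integral>\<^sup>+x. (v x + u x) * J x \<partial>M) = (\<integral>\<^sup>+x. v x * J x \<partial>M) + (\<integral>\<^sup>+x. u x * J x \<partial>M)"
    using add J by (simp add: distrib_right nn_integral_add)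
  moreover have u [measurable]: "(\<lambda>y. \<integral>\<^sup>+x. u x \<partial>count_space {x \<in> space M. \<phi> x = y}) \<in> borel_measurable M'"
    and v [measurable]: "(\<lambda>y. \<integral>\<^sup>+x. v x \<partial>count_space {x \<in> space M. \<phi> x = y}) \<in> borel_measurable M'"
    using add by blast+
  moreover have "(\<lambda>y. (\<integral>\<^sup>+x. v x \<partial>count_space {x \<in> space M. \<phi> x = y})
      + (\<integral>\<^sup>+x. u x \<partial>count_space {x \<in> space M. \<phi> x = y})) \<in> borel_measurable M'"
    by measurable
  ultimately show ?case
    using add by (simp add: nn_integral_add)
next
  case (seq U)
  have U: "(\<lambda>y. \<integral>\<^sup>+x. U i x \<partial>count_space {x \<in> space M. \<phi> x = y}) \<in> borel_measurable M'" for i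
    using seq by blast
  then have SUPm: "(\<lambda>y. SUP i. \<integral>\<^sup>+x. U i x \<partial>count_space {x \<in> space M. \<phi> x = y}) \<in> borel_measurable M'"
    by (intro borel_measurable_SUP) auto
  have fib: "(\<integral>\<^sup>+x. (SUP i. U i x) \<partial>count_space {x \<in> space M. \<phi> x = y})
      = (SUP i. \<integral>\<^sup>+x. U i x \<partial>count_space {x \<in> space M. \<phi> x = y})" for y
    using seq by (intro nn_integral_monotone_convergence_SUP) auto
  have inc: "incseq (\<lambda>i y. \<integral>\<^sup>+x. U i x \<partial>count_space {x \<in> space M. \<phi> x = y})"
    using seq by (auto simp: incseq_def le_fun_def intro!: nn_integral_mono)
  have "(\<integral>\<^sup>+y. (SUP i. \<integral>\<^sup>+x. U i x \<partial>count_space {x \<in> space M. \<phi> x = y}) \<partial>M')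
      = (SUP i. \<integral>\<^sup>+y. (\<integral>\<^sup>+x. U i x \<partial>count_space {x \<in> space M. \<phi> x = y}) \<partial>M')"
    using U inc by (intro nn_integral_monotone_convergence_SUP) auto
  also have "\<dots> = (SUP i. \<integral>\<^sup>+x. U i x * J x \<partial>M)"
    using seq by simp
  also have "\<dots> = (\<integral>\<^sup>+x. (SUP i. U i x * J x) \<partial>M)"
  proof (rule nn_integral_monotone_convergence_SUP[symmetric])
    show "incseq (\<lambda>i x. U i x * J x)"
      using seq by (auto simp: incseq_def le_fun_def intro!: mult_right_mono)
    show "(\<lambda>x. U i x * J x) \<in> borel_measurable M" for i
      using seq J by auto
  qed
  also have "\<dots> = (\<integral>\<^sup>+x. (SUP i. U i x) * J x \<partial>M)"
    by (simp add: SUP_mult_right_ennreal)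
  finally show ?case
    using SUPm by (simp only: fib SUP_apply image_image simp_thms)
qed

text \<open>By completeness of Lebesgue measure: according to whether B contains 0, the complement
  of the preimage of B or the preimage itself lies in the null set W.\<close>

lemma borel_measurable_negligible_support:
  fixes g :: "'a::euclidean_space \<Rightarrow> ennreal"
  assumes W: "negligible W" and g: "\<And>y. y \<notin> W \<Longrightarrow> g y = 0"
  shows "g \<in> borel_measurable lebesgue" "(\<integral>\<^sup>+y. g y \<partial>lebesgue) = 0"
proof -
  show "g \<in> borel_measurable lebesgue"
  proof (rule measurableI)
    fix B :: "ennreal set"
    show "g -` B \<inter> space lebesgue \<in> sets lebesgue"
    proof (cases "0 \<in> B")
      case True
      then have "- (g -` B) \<subseteq> W" using g by auto
      then have "- (g -` B) \<in> sets lebesgue"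
        using W negligible_subset negligible_imp_sets by blast
      then show ?thesis by (metis Compl_in_sets_lebesgue Int_UNIV_right space_completion space_lborel space_borel double_complement)
    next
      case False
      then have "x \<in> W" if "g x \<in> B" for x
        using that g[of x] by (cases "x \<in> W") auto
      then have "g -` B \<subseteq> W" by auto
      then show ?thesis
        using W negligible_subset negligible_imp_sets by (metis inf_top_right space_borel space_completion space_lborel)
    qed
  qed simp
  have "AE y in lebesgue. g y = 0"
    by (rule AE_I'[of W]) (use W g in \<open>auto simp: negligible_iff_null_sets\<close>)
  then have "(\<integral>\<^sup>+y. g y \<partial>lebesgue) = (\<integral>\<^sup>+y. 0 \<partial>(lebesgue :: 'a measure))"
    by (rule nn_integral_cong_AE)
  then show "(\<integral>\<^sup>+y. g y \<partial>lebesgue) = 0" by simp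
qed

section \<open>Fibre sums on pieces with null image and on injective pieces\<close>

lemma fibre_sum_indicator_negligible_image:
  fixes \<phi> :: "'a::euclidean_space \<Rightarrow> 'b::euclidean_space"
  assumes W: "negligible (\<phi> ` C)"
  shows "(\<lambda>y. \<integral>\<^sup>+x. indicator C x \<partial>count_space {x \<in> T. \<phi> x = y}) \<in> borel_measurable lebesgue"
    and "(\<integral>\<^sup>+y. (\<integral>\<^sup>+x. indicator C x \<partial>count_space {x \<in> T. \<phi> x = y}) \<partial>lebesgue) = 0"
proof -
  have zero: "(\<integral>\<^sup>+x. indicator C x \<partial>count_space {x \<in> T. \<phi> x = y}) = 0" if "y \<notin> \<phi> ` C" for y
  proof -
    have "(\<integral>\<^sup>+x. indicator C x \<partial>count_space {x \<in> T. \<phi> x = y}) = (\<integral>\<^sup>+x. 0 \<partial>count_space {x \<in> T. \<phi> x = y})"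
      using that by (intro nn_integral_cong) (auto simp: indicator_def)
    then show ?thesis by simp
  qed
  show "(\<lambda>y. \<integral>\<^sup>+x. indicator C x \<partial>count_space {x \<in> T. \<phi> x = y}) \<in> borel_measurable lebesgue"
    by (rule borel_measurable_negligible_support(1)[OF W zero])
  show "(\<integral>\<^sup>+y. (\<integral>\<^sup>+x. indicator C x \<partial>count_space {x \<in> T. \<phi> x = y}) \<partial>lebesgue) = 0"
    by (rule borel_measurable_negligible_support(2)[OF W zero])
qed

lemma fibre_sum_indicator_inj_on:
  assumes inj: "inj_on \<phi> C" and C: "C \<subseteq> T"
  shows "(\<integral>\<^sup>+x. indicator C x \<partial>count_space {x \<in> T. \<phi> x = y}) = indicator (\<phi> ` C) y"
proof (cases "y \<in> \<phi> ` C")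
  case True
  then obtain x where x: "x \<in> C" "y = \<phi> x" by blast
  have "(\<integral>\<^sup>+x. indicator C x \<partial>count_space {x \<in> T. \<phi> x = y}) = (\<Sum>z\<in>{x}. indicator C z)"
    using x C inj by (intro nn_integral_count_space') (auto simp: indicator_def inj_on_eq_iff split: if_splits)
  then show ?thesis using x by simp
next
  case False
  then have "(\<integral>\<^sup>+x. indicator C x \<partial>count_space {x \<in> T. \<phi> x = y}) = (\<integral>\<^sup>+x. 0 \<partial>count_space {x \<in> T. \<phi> x = y})"
    by (intro nn_integral_cong) (auto simp: indicator_def)
  then show ?thesis using False by simp
qed

text \<open>The inequality is demanded against all \<open>z\<close> of \<open>S\<close>, so that it
  passes to limits in \<open>x\<close> with \<open>z\<close> fixed. One number \<open>N\<close>
  controls both the scale and the expansion constant, so countably many sets suffice.\<close>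

definition expanding_set :: "('a::real_normed_vector \<Rightarrow> 'b::real_normed_vector) \<Rightarrow> 'a set \<Rightarrow> nat \<Rightarrow> 'a set" where
  "expanding_set \<phi> S N = {x \<in> S. \<forall>z\<in>S. norm (z - x) < 1 / real (Suc N) \<longrightarrow>
    norm (z - x) \<le> real (Suc N) * norm (\<phi> z - \<phi> x)}"

text \<open>The set is closed relative to S: a z at distance less than 1/(N+1) from x is, by the
  strict inequality, also that close to late members of a sequence tending to x, and the expansion
  estimate passes to the limit.\<close>

lemma expanding_set_lebesgue:
  fixes \<phi> :: "'a::euclidean_space \<Rightarrow> 'b::real_normed_vector"
  assumes S: "S \<in> sets lebesgue" and cont: "continuous_on S \<phi>"
  shows "expanding_set \<phi> S N \<in> sets lebesgue"
proof -
  let ?P = "expanding_set \<phi> S N"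
  have "S \<inter> closure ?P \<subseteq> ?P"
  proof
    fix x assume x: "x \<in> S \<inter> closure ?P"
    then have "\<exists>p. (\<forall>n. p n \<in> ?P) \<and> p \<longlonglongrightarrow> x"
      by (simp add: closure_sequential[symmetric])
    then obtain p where p: "\<And>n. p n \<in> ?P" "p \<longlonglongrightarrow> x"
      by blast
    have pS: "p n \<in> S" for n
      using p(1)[of n] by (simp add: expanding_set_def)
    have \<phi>p: "(\<lambda>n. \<phi> (p n)) \<longlonglongrightarrow> \<phi> x"
      by (rule continuous_on_tendsto_compose[OF cont p(2)]) (use x pS in auto)
    have "norm (z - x) \<le> real (Suc N) * norm (\<phi> z - \<phi> x)"
      if z: "z \<in> S" "norm (z - x) < 1 / real (Suc N)" for z
    proof (rule tendsto_le[OF sequentially_bot])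
      show "(\<lambda>n. norm (z - p n)) \<longlonglongrightarrow> norm (z - x)"
        by (intro tendsto_intros p)
      then have "\<forall>\<^sub>F n in sequentially. norm (z - p n) < 1 / real (Suc N)"
        using z by (intro order_tendstoD(2))
      then show "\<forall>\<^sub>F n in sequentially. norm (z - p n) \<le> real (Suc N) * norm (\<phi> z - \<phi> (p n))"
      proof (rule eventually_mono)
        fix n assume "norm (z - p n) < 1 / real (Suc N)"
        then show "norm (z - p n) \<le> real (Suc N) * norm (\<phi> z - \<phi> (p n))"
          using p(1)[of n] z(1) by (simp add: expanding_set_def)
      qed
      show "(\<lambda>n. real (Suc N) * norm (\<phi> z - \<phi> (p n))) \<longlonglongrightarrow> real (Suc N) * norm (\<phi> z - \<phi> x)"
        by (intro tendsto_intros \<phi>p)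
    qed
    then show "x \<in> ?P" using x by (simp add: expanding_set_def)
  qed
  moreover have "?P \<subseteq> S \<inter> closure ?P"
    using closure_subset[of ?P] by (auto simp: expanding_set_def)
  ultimately have "?P = S \<inter> closure ?P" by blast
  moreover have "closure ?P \<in> sets lebesgue"
    by (simp add: borel_closed)
  ultimately show ?thesis using S by (metis sets.Int)
qed

lemma inj_on_expanding_set:
  assumes "\<And>x z. x \<in> B \<Longrightarrow> z \<in> B \<Longrightarrow> norm (z - x) < 1 / real (Suc N)"
  shows "inj_on \<phi> (expanding_set \<phi> S N \<inter> B)"
proof (rule inj_onI)
  fix x z assume xz: "x \<in> expanding_set \<phi> S N \<inter> B" "z \<in> expanding_set \<phi> S N \<inter> B" "\<phi> x = \<phi> z"
  then have "z \<in> S" "norm (z - x) < 1 / real (Suc N)"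
    using assms by (auto simp: expanding_set_def)
  then have "norm (z - x) \<le> real (Suc N) * norm (\<phi> z - \<phi> x)"
    using xz(1) by (simp add: expanding_set_def)
  then show "x = z" using xz(3) by simp
qed

text \<open>An invertible L satisfies |L h| \<ge> B |h|. Close to x the error of the linear
  approximation consumes at most half of this, leaving |phi(z) - phi(x)| \<ge> (B/2) |z -
  x|.\<close>

lemma mem_expanding_set:
  fixes \<phi> :: "real^'n \<Rightarrow> real^'n"
  assumes x: "x \<in> S" and der: "(\<phi> has_derivative L) (at x within S)" and det: "det (matrix L) \<noteq> 0"
  shows "\<exists>N. x \<in> expanding_set \<phi> S N"
proof -
  have lin: "linear L" using der by (rule has_derivative_linear)
  then have "inj L" using det det_nz_iff_inj by blast
  then obtain B where B: "0 < B" "\<And>h. B * norm h \<le> norm (L h)"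
    using linear_inj_bounded_below_pos[OF lin] by blast
  then have "0 < B / 2" by simp
  with der obtain d where d: "0 < d" and small: "\<And>z. z \<in> S \<Longrightarrow> norm (z - x) < d \<Longrightarrow>
      norm (\<phi> z - \<phi> x - L (z - x)) \<le> B / 2 * norm (z - x)"
    unfolding has_derivative_within_alt by blast
  have "0 < min d (B / 2)" using d B by simp
  then obtain N where N: "1 / real (Suc N) < min d (B / 2)"
    by (rule nat_approx_posE)
  have "norm (z - x) \<le> real (Suc N) * norm (\<phi> z - \<phi> x)"
    if z: "z \<in> S" "norm (z - x) < 1 / real (Suc N)" for z
  proof -
    have "norm (\<phi> z - \<phi> x - L (z - x)) \<le> B / 2 * norm (z - x)"
      using small z N by simp
    moreover have "norm (L (z - x)) \<le> norm (\<phi> z - \<phi> x) + norm (\<phi> z - \<phi> x - L (z - x))"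
      using norm_triangle_ineq4[of "\<phi> z - \<phi> x" "\<phi> z - \<phi> x - L (z - x)"] by simp
    ultimately have "B / 2 * norm (z - x) \<le> norm (\<phi> z - \<phi> x)"
      using B(2)[of "z - x"] by simp
    moreover have "1 / real (Suc N) * norm (z - x) \<le> B / 2 * norm (z - x)"
      using N by (intro mult_right_mono) auto
    ultimately have "1 / real (Suc N) * norm (z - x) \<le> norm (\<phi> z - \<phi> x)"
      by linarith
    then show ?thesis by (simp add: field_simps)
  qed
  then show ?thesis using x by (auto simp: expanding_set_def)
qed

text \<open>Disposes of the exceptional null set, where the value of the approximate Jacobian may be
  unspecified.\<close>

lemma borel_measurable_on_negligible:
  assumes "negligible Z"
  shows "f \<in> borel_measurable (lebesgue_on Z)"
proof (rule measurableI)
  fix B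
  have "f -` B \<inter> Z \<in> sets lebesgue"
    using assms by (intro negligible_imp_sets) (auto intro: negligible_subset)
  then show "f -` B \<inter> space (lebesgue_on Z) \<in> sets (lebesgue_on Z)"
    using negligible_imp_sets[OF assms] by (simp add: sets_restrict_space_iff)
qed simp

lemma negligible_Lipschitz_image:
  fixes f :: "'a::euclidean_space \<Rightarrow> 'b::euclidean_space"
  assumes "DIM('a) \<le> DIM('b)" "L-lipschitz_on S f" "negligible N" "N \<subseteq> S"
  shows "negligible (f ` N)"
proof (rule negligible_locally_Lipschitz_image[OF assms(1,3)])
  fix x assume "x \<in> N"
  then have "norm (f y - f x) \<le> L * norm (y - x)" if "y \<in> N" for y
    using lipschitz_on_normD[OF assms(2)] that assms(4) by blast
  then show "\<exists>T B. open T \<and> x \<in> T \<and> (\<forall>y\<in>N \<inter> T. norm (f y - f x) \<le> B * norm (y - x))"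
    by (intro exI[of _ UNIV] exI[of _ L]) auto
qed

text \<open>Existence of the approximate derivative almost everywhere and measurability of both
  integrands belong to the claim: \<open>THE\<close> and the nonnegative integral yield values in
  any case, so the equation alone would say less.\<close>

theorem theorem1p1:
  fixes A S :: "(real^'n) set"
    and \<phi> :: "real^'n \<Rightarrow> real^'n"
    and Am :: "nat \<Rightarrow> (real^'n) set"
    and f :: "real^'n \<Rightarrow> real"
  assumes "A \<in> sets lebesgue"
    and "\<phi> \<in> borel_measurable (lebesgue_on A)"
    and "\<And>m. Am m \<in> sets lebesgue"
    and "\<And>m. Am m \<subseteq> A"
    and "\<And>m. Am m \<subseteq> Am (Suc m)"
    and "\<And>m. \<exists>C. C-lipschitz_on (Am m) \<phi>"
    and "S = A - (\<Union>m. Am m)"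
    and "f \<in> borel_measurable (lebesgue_on A)"
    and "\<And>x. x \<in> A \<Longrightarrow> f x \<ge> 0"
  shows "(AE x in lebesgue_on (A - S). \<exists>L. has_approx_derivative A \<phi> x L) \<and>
    (\<lambda>x. f x * \<bar>approx_jacobian A \<phi> x\<bar>) \<in> borel_measurable (lebesgue_on (A - S)) \<and>
    (\<lambda>y. \<Sum>\<^sub>\<infinity>x\<in>{x \<in> A. \<phi> x = y} \<inter> (A - S). ennreal (f x)) \<in> borel_measurable lebesgue \<and>
    (\<integral>\<^sup>+x. ennreal (f x * \<bar>approx_jacobian A \<phi> x\<bar>) \<partial>lebesgue_on (A - S)) =
      (\<integral>\<^sup>+y. (\<Sum>\<^sub>\<infinity>x\<in>{x \<in> A. \<phi> x = y} \<inter> (A - S). ennreal (f x)) \<partial>lebesgue)"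
proof -
  obtain Lm where lip: "\<And>m. (Lm m)-lipschitz_on (Am m) \<phi>"
    using assms(6) by metis
  define T where "T = A - S"
  have T_eq: "T = (\<Union>m. Am m)"
    using assms(4) by (auto simp: T_def assms(7))
  then have T: "T \<in> sets lebesgue" using assms(3) by auto
  have TA: "T \<subseteq> A" by (auto simp: T_def)
  define F where "F x = approx_derivative A \<phi> x" for x
  let ?det = "\<lambda>x. det (matrix (F x))"
  define D where "D m = {x \<in> Am m. has_lebesgue_density (Am m) x 1 \<and> \<phi> differentiable (at x within Am m)}" for m
  have DA: "D m \<subseteq> Am m" for m by (auto simp: D_def)
  have DT: "D m \<subseteq> T" for m using DA T_eq by blast
  have neg_AD: "negligible (Am m - D m)" for m
  proof (rule negligible_subset)
    show "negligible ({x \<in> Am m. \<not> has_lebesgue_density (Am m) x 1} \<union>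
        {x \<in> Am m. \<not> \<phi> differentiable (at x within Am m)})"
      by (intro negligible_Un negligible_not_density_1 assms(3) Rademacher_within[OF lip])
  qed (auto simp: D_def)
  have D: "D m \<in> sets lebesgue" for m
  proof -
    have "D m = Am m - (Am m - D m)" using DA by blast
    then show ?thesis
      using assms(3) negligible_imp_sets[OF neg_AD] by (metis sets.Diff)
  qed
  \<comment> \<open>\<open>F\<close> does not mention m: any derivative within \<open>Am m\<close>
    at a point of \<open>D m\<close> is the approximate derivative, and uniqueness identifies it
    with \<open>F x\<close>.\<close>
  have approx: "has_approx_derivative A \<phi> x (F x) \<and> (\<phi> has_derivative F x) (at x within Am m)"
    if x: "x \<in> D m" for x m
  proof -
    obtain L where L: "(\<phi> has_derivative L) (at x within Am m)"
      using x by (auto simp: D_def differentiable_def)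
    have "has_approx_derivative A \<phi> x L"
      using x assms(4) by (intro has_approx_derivative_if_has_derivative_within[OF assms(1,2) _ _ _ L])
        (auto simp: D_def)
    moreover from this have "F x = L"
      unfolding F_def by (rule approx_derivative_eq)
    ultimately show ?thesis using L by simp
  qed
  have der: "(\<phi> has_derivative F x) (at x within C)" if "x \<in> C" "C \<subseteq> D m" for x C m
    using approx[of x m] that DA by (meson has_derivative_subset subset_iff subset_trans)
  define Z where "Z = T - (\<Union>m. D m)"
  have Z_sub: "Z \<subseteq> (\<Union>m. Am m - D m)"
    by (auto simp: Z_def T_eq)
  then have Z: "negligible Z"
    by (rule negligible_subset[rotated]) (intro negligible_UN_countable neg_AD, simp)
  have ZT: "Z \<subseteq> T" by (auto simp: Z_def)
  \<comment> \<open>A merely measurable map may enlarge null sets; here each part of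
    \<open>Z\<close> lies in some \<open>Am m\<close>, on which phi is Lipschitz.\<close>
  have \<phi>Z: "negligible (\<phi> ` Z)"
  proof (rule negligible_subset)
    show "negligible (\<Union>m. \<phi> ` (Am m - D m))"
      by (intro negligible_UN_countable negligible_Lipschitz_image[OF order_refl lip neg_AD]) auto
  qed (use Z_sub in blast)
  have det_meas: "?det \<in> borel_measurable (lebesgue_on T)"
  proof (rule measurable_piecewise_restrict[of "insert Z (range D)"])
    show "countable (insert Z (range D))" by simp
    show "space (lebesgue_on T) \<subseteq> \<Union> (insert Z (range D))"
      by (auto simp: Z_def)
    fix \<Omega> assume \<Omega>: "\<Omega> \<in> insert Z (range D)"
    then have sets: "\<Omega> \<in> sets lebesgue" "\<Omega> \<subseteq> T"
      using D DT negligible_imp_sets[OF Z] ZT by auto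
    then show "\<Omega> \<inter> space (lebesgue_on T) \<in> sets (lebesgue_on T)"
      using T by (simp add: sets_restrict_space_iff Int_absorb2)
    have "restrict_space (lebesgue_on T) \<Omega> = lebesgue_on \<Omega>"
      using sets T by (simp add: restrict_restrict_space Int_absorb1)
    moreover have "?det \<in> borel_measurable (lebesgue_on \<Omega>)"
    proof (cases "\<Omega> = Z")
      case True
      then show ?thesis using Z borel_measurable_on_negligible by blast
    next
      case False
      then obtain m where "\<Omega> = D m" using \<Omega> by blast
      then show ?thesis
        using der by (intro borel_measurable_det_jacobian sets(1)) blast
    qed
    ultimately show "?det \<in> borel_measurable (restrict_space (lebesgue_on T) \<Omega>)" by simp
  qed
  define J where "J x = ennreal \<bar>?det x\<bar>" for x
  have J: "J \<in> borel_measurable (lebesgue_on T)"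
    unfolding J_def using det_meas by (intro measurable_compose[OF borel_measurable_abs measurable_ennreal])
  define N where "N g y = (\<integral>\<^sup>+x. g x \<partial>count_space {x \<in> T. \<phi> x = y})" for g :: "real^'n \<Rightarrow> ennreal" and y
  have det0: "{x \<in> D m. ?det x = 0} \<in> sets lebesgue" for m
  proof -
    have "{x \<in> space (lebesgue_on T). ?det x = 0} \<in> sets (lebesgue_on T)"
      using det_meas by measurable
    then have "{x \<in> T. ?det x = 0} \<in> sets lebesgue"
      using T by (simp add: sets_restrict_space_iff)
    moreover have "{x \<in> D m. ?det x = 0} = D m \<inter> {x \<in> T. ?det x = 0}"
      using DT by blast
    ultimately show ?thesis using D by simp
  qed
  obtain Q :: "(real^'n) set" where Q: "countable Q" "\<And>X. open X \<Longrightarrow> X \<noteq> {} \<Longrightarrow> \<exists>q\<in>Q. q \<in> X"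
    using countable_dense_setE by blast
  \<comment> \<open>The ball has diameter at most 1/(k+1), the scale of the expanding set, so phi is
    injective on the intersection. Centres from the countable dense set \<open>Q\<close> keep the
    family countable.\<close>
  define E where "E = (\<lambda>(m, k, q). D m \<inter> (expanding_set \<phi> (Am m) k \<inter> ball q (1 / (2 * real (Suc k)))))"
  define \<C> where "\<C> = insert Z (range (\<lambda>m. {x \<in> D m. ?det x = 0}) \<union> E ` (UNIV \<times> UNIV \<times> Q))"
  have contm: "continuous_on (Am m) \<phi>" for m
    using lip by (rule lipschitz_on_continuous_on)
  have E_sets: "E (m, k, q) \<in> sets lebesgue" for m k q
    unfolding E_def prod.case
    by (intro sets.Int D expanding_set_lebesgue assms(3) contm) simp
  have \<C>_sets: "C \<in> sets lebesgue \<and> C \<subseteq> T" if C: "C \<in> \<C>" for C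
  proof -
    consider "C = Z" | m where "C = {x \<in> D m. ?det x = 0}" | m k q where "C = E (m, k, q)"
      using C unfolding \<C>_def by blast
    then show ?thesis
    proof cases
      case 1
      then show ?thesis using negligible_imp_sets[OF Z] ZT by simp
    next
      case 2
      then show ?thesis using det0 DT by blast
    next
      case 3
      moreover have "E (m, k, q) \<subseteq> D m" by (auto simp: E_def)
      ultimately show ?thesis using E_sets DT by blast
    qed
  qed
  have "x \<in> \<Union>\<C>" if x: "x \<in> T" for x
  proof (cases "x \<in> Z")
    case True
    then show ?thesis by (auto simp: \<C>_def)
  next
    case False
    then obtain m where m: "x \<in> D m" using x by (auto simp: Z_def)
    show ?thesis
    proof (cases "?det x = 0")
      case True
      with m show ?thesis unfolding \<C>_def by blast
    next
      case False
      then obtain k where k: "x \<in> expanding_set \<phi> (Am m) k"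
        using mem_expanding_set approx[OF m] m DA by blast
      obtain q where q: "q \<in> Q" "q \<in> ball x (1 / (2 * real (Suc k)))"
        using Q(2)[of "ball x (1 / (2 * real (Suc k)))"] by auto
      then have "x \<in> ball q (1 / (2 * real (Suc k)))" by (simp add: dist_commute)
      then have "x \<in> E (m, k, q)"
        using m k by (simp add: E_def)
      moreover have "E (m, k, q) \<in> \<C>" using q by (auto simp: \<C>_def)
      ultimately show ?thesis by blast
    qed
  qed
  then have cover: "T = \<Union>\<C>"
    using \<C>_sets by blast
  have count: "countable \<C>"
    unfolding \<C>_def using Q(1) by (intro countable_insert countable_Un countable_image countable_SIGMA) auto
  \<comment> \<open>Pieces with null image contribute nothing to either side: for \<open>Z\<close>
    the domain is null, for the critical pieces the Jacobian vanishes.\<close>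
  have negligible_piece: "N (indicator C) \<in> borel_measurable lebesgue \<and>
      (\<integral>\<^sup>+y. N (indicator C) y \<partial>lebesgue) = (\<integral>\<^sup>+x. indicator C x * J x \<partial>lebesgue_on T)"
    if "negligible (\<phi> ` C)" "(\<integral>\<^sup>+x. indicator C x * J x \<partial>lebesgue_on T) = 0" for C
    unfolding N_def[abs_def] that(2)
    by (intro conjI fibre_sum_indicator_negligible_image[OF that(1)])
  have piece: "N (indicator C) \<in> borel_measurable lebesgue \<and>
      (\<integral>\<^sup>+y. N (indicator C) y \<partial>lebesgue) = (\<integral>\<^sup>+x. indicator C x * J x \<partial>lebesgue_on T)"
    if P: "P \<in> \<C>" and C: "C \<in> sets (lebesgue_on T)" "C \<subseteq> P" for C P
  proof -
    have CT: "C \<in> sets lebesgue" "C \<subseteq> T"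
      using C(1) T by (auto simp: sets_restrict_space_iff)
    consider "P = Z" | m where "P = {x \<in> D m. ?det x = 0}" | m k q where "P = E (m, k, q)"
      using P unfolding \<C>_def by blast
    then show ?thesis
    proof cases
      case 1
      have "negligible C" using Z C(2) 1 by (auto intro: negligible_subset)
      then have "C \<in> null_sets (lebesgue_on T)"
        using CT T by (simp add: null_sets_restrict_space negligible_iff_null_sets)
      then have "(\<integral>\<^sup>+x. J x * indicator C x \<partial>lebesgue_on T) = 0"
        by (rule nn_integral_null_set)
      moreover have "negligible (\<phi> ` C)"
        using \<phi>Z by (rule negligible_subset) (use C(2) 1 in blast)
      ultimately show ?thesis
        by (intro negligible_piece) (simp_all add: mult.commute)
    next
      case 2
      have "negligible (\<phi> ` C)"
      proof (rule Sard_det_0)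
        show "(\<phi> has_derivative F x) (at x within C)" "?det x = 0" if "x \<in> C" for x
          using that C(2) 2 by (auto intro!: der[of x C m])
      qed
      moreover have "(\<integral>\<^sup>+x. indicator C x * J x \<partial>lebesgue_on T) = (\<integral>\<^sup>+x. 0 \<partial>lebesgue_on T)"
        using C(2) 2 by (intro nn_integral_cong) (auto simp: J_def indicator_def)
      ultimately show ?thesis
        by (intro negligible_piece) simp_all
    next
      case 3
      have CD: "C \<subseteq> D m" and CE: "C \<subseteq> expanding_set \<phi> (Am m) k \<inter> ball q (1 / (2 * real (Suc k)))"
        using C(2) 3 by (auto simp: E_def)
      have "inj_on \<phi> (expanding_set \<phi> (Am m) k \<inter> ball q (1 / (2 * real (Suc k))))"
      proof (rule inj_on_expanding_set)
        fix x z assume "x \<in> ball q (1 / (2 * real (Suc k)))" "z \<in> ball q (1 / (2 * real (Suc k)))"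
        then have "dist z x < 1 / (2 * real (Suc k)) + 1 / (2 * real (Suc k))"
          using dist_triangle3[of z x q] unfolding mem_ball by linarith
        then show "norm (z - x) < 1 / real (Suc k)"
          by (simp add: dist_norm field_simps)
      qed
      then have inj: "inj_on \<phi> C"
        using CE by (rule inj_on_subset)
      have dC: "(\<phi> has_derivative F x) (at x within C)" if "x \<in> C" for x
        using that CD by (rule der)
      have im: "\<phi> ` C \<in> sets lebesgue"
        using dC by (intro differentiable_image_in_sets_lebesgue CT(1))
          (auto simp: differentiable_on_def differentiable_def)
      have N: "N (indicator C) y = indicator (\<phi> ` C) y" for y
        unfolding N_def by (rule fibre_sum_indicator_inj_on[OF inj CT(2)])
      have "(\<integral>\<^sup>+y. N (indicator C) y \<partial>lebesgue) = emeasure lebesgue (\<phi> ` C)"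
        using im by (simp add: N)
      also have "\<dots> = (\<integral>\<^sup>+x. J x \<partial>lebesgue_on C)"
        unfolding J_def by (rule emeasure_differentiable_image[OF CT(1) dC inj])
      also have "\<dots> = (\<integral>\<^sup>+x. J x * indicator C x \<partial>lebesgue)"
        using CT by (simp add: nn_integral_restrict_space)
      also have "\<dots> = (\<integral>\<^sup>+x. indicator C x * J x * indicator T x \<partial>lebesgue)"
        using CT by (intro nn_integral_cong) (auto simp: indicator_def)
      also have "\<dots> = (\<integral>\<^sup>+x. indicator C x * J x \<partial>lebesgue_on T)"
        using T by (simp add: nn_integral_restrict_space)
      finally show ?thesis
        using im by (simp add: N[abs_def])
    qed
  qed
  have fT: "f \<in> borel_measurable (lebesgue_on T)"
    using measurable_restrict_mono[OF assms(8) TA] .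
  have area: "N (\<lambda>x. ennreal (f x)) \<in> borel_measurable lebesgue \<and>
      (\<integral>\<^sup>+y. N (\<lambda>x. ennreal (f x)) y \<partial>lebesgue) = (\<integral>\<^sup>+x. ennreal (f x) * J x \<partial>lebesgue_on T)"
  proof -
    have space: "space (lebesgue_on T) = T" by simp
    have g: "(\<lambda>x. ennreal (f x)) \<in> borel_measurable (lebesgue_on T)"
      by (rule measurable_compose[OF fT measurable_ennreal])
    have \<C>_sub: "\<C> \<subseteq> sets (lebesgue_on T)"
      using \<C>_sets T by (auto simp: sets_restrict_space_iff)
    have "space (lebesgue_on T) = \<Union>\<C>" using cover by simp
    from nn_integral_fibre_sum[OF J count \<C>_sub this _ g, of \<phi> lebesgue] piece
    show ?thesis
      unfolding N_def[abs_def] space by blast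
  qed
  have sum_eq: "(\<Sum>\<^sub>\<infinity>x\<in>{x \<in> A. \<phi> x = y} \<inter> T. ennreal (f x)) = N (\<lambda>x. ennreal (f x)) y" for y
  proof -
    have "{x \<in> A. \<phi> x = y} \<inter> T = {x \<in> T. \<phi> x = y}" by (auto simp: T_def)
    then show ?thesis by (simp add: infsum_eq_nn_integral_count_space N_def)
  qed
  have "AE x in lebesgue_on T. \<exists>L. has_approx_derivative A \<phi> x L"
  proof (rule AE_I')
    show "Z \<in> null_sets (lebesgue_on T)"
      using Z ZT T by (simp add: null_sets_restrict_space negligible_iff_null_sets)
    show "{x \<in> space (lebesgue_on T). \<not> (\<exists>L. has_approx_derivative A \<phi> x L)} \<subseteq> Z"
      using approx by (auto simp: Z_def)
  qed
  moreover have "(\<lambda>x. f x * \<bar>approx_jacobian A \<phi> x\<bar>) \<in> borel_measurable (lebesgue_on T)"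
    unfolding approx_jacobian_def F_def[symmetric]
    by (intro borel_measurable_times borel_measurable_abs fT det_meas)
  moreover have "(\<integral>\<^sup>+x. ennreal (f x * \<bar>approx_jacobian A \<phi> x\<bar>) \<partial>lebesgue_on T)
      = (\<integral>\<^sup>+x. ennreal (f x) * J x \<partial>lebesgue_on T)"
    using assms(9) TA
    by (intro nn_integral_cong) (auto simp: J_def approx_jacobian_def F_def ennreal_mult')
  ultimately show ?thesis
    unfolding T_def[symmetric] sum_eq using area by simp
qed

end
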